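(* Let $\tau\in\{A',A,B,C,D\}$ and let $(G_N)_N$ be the sequence of compact classical groups of type $\tau$ with $G_N\subset \mathrm{GL}_N(\mathbb C)$. For $t>0$ put $q_t=e^{-t/2}$, and let $\alpha,\beta,n$ be independent random variables, where $\alpha,\beta$ are $q_t$-uniform random partitions and $n$ has the integer Gaussian distribution with parameter $q_t$. Then for every $t>0$ and every integer $p\ge 1$, as $N\to\infty$: (1) If $\tau\in\{A',A\}$ (i.e. $G_N=\mathrm U(N)$ or $\mathrm{SU}(N)$), $$\mathrm{Tr}\big(e^{\frac t2\Delta_{G_N}}\big)=\sum_{k=0}^p\frac{a^\tau_{2k}(t)}{N^{2k}}+O_t(N^{-2p-2}),$$ where $$a^{A'}_{2k}(t)=\frac{\theta(q_t)\,t^{2k}}{\phi(q_t)^2(2k)!}\,\mathbb E\Big[\big(K(\alpha)+K(\beta)+n(|\alpha|-|\beta|)\big)^{2k}\Big],$$ $$a^{A}_{2k}(t)=\frac1{\phi(q_t)^2}\sum_{k_1+k_2+k_3=k}t^{2k-k_3}\,\frac{\mathbb E\big[K(\alpha)^{2k_1}K(\beta)^{2k_2}(|\alpha|-|\beta|)^{2k_3}\big]}{2^{k_3}(2k_1)!(2k_2)!\,k_3!},$$ the last sum being over integers $k_1,k_2,k_3\ge0$. (2) If $\tau\in\{B,C,D\}$ (i.e. $G_N=\mathrm{SO}(N)$ with $N$ odd, $\mathrm{Sp}(N/2)$ with $N$ even, $\mathrm{SO}(N)$ with $N$ even, respectively), $$\mathrm{Tr}\big(e^{\frac t2\Delta_{G_N}}\big)=\sum_{k=0}^p\frac{a^\tau_{k}(t)}{N^{k}}+O_t(N^{-p-1}),$$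 where $$a_k^B(t)=a_k^D(t)=\frac{(-t)^k}{\phi(q_t)\,k!}\,\mathbb E\Big[\big(K(\alpha)-\tfrac12|\alpha|\big)^k\Big],\qquad a_k^C(t)=\frac{(-t)^k}{\phi(q_t)\,k!}\,\mathbb E\Big[\big(K(\alpha)+\tfrac12|\alpha|\big)^k\Big].$$
   Context: **Groups and central heat trace.** Compact classical groups are indexed by matrix size $N$, $G_N\subset\mathrm{GL}_N(\mathbb C)$: type $A'$: $\mathrm U(N)$; type $A$: $\mathrm{SU}(N)$; type $B$: $\mathrm{SO}(N)$ with $N$ odd; type $D$: $\mathrm{SO}(N)$ with $N$ even; type $C$: $\mathrm{Sp}(N/2)=\{S\in\mathrm{GL}_N(\mathbb C):S^*=S^{-1},S^tJS=J\}$ with $N$ even, $J=\begin{pmatrix}0&I\\-I&0\end{pmatrix}$. $N\to\infty$ through the values admissible for the type. The Lie algebra $\mathfrak g_N$ carries the inner product $\langle X,Y\rangle=c_N\mathrm{Tr}(X^*Y)$ with $c_N=N$ for types $A',A$ and $c_N=N/2$ for types $B,C,D$. With an orthonormal basis $(X_i)$ of $\mathfrak g_N$, $\Delta_{G_N}f(g)=\sum_i\frac{d^2}{ds^2}\big|_{s=0}f(ge^{sX_i})$. For an irreducible representation $\lambda\in\widehat G_N$ with character $\chi_\lambda$, $\Delta_{G_N}\chi_\lambda=-c_2(\lambda)\chi_\lambda$, $c_2(\lambda)\ge0$. The central heat trace is the trace of $e^{\frac t2\Delta_{G_N}}$ on the Hilbert space of square-integrable central (conjugation-invariant) functions: $$\mathrm{Tr}(e^{\frac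 t2\Delta_{G_N}})=\sum_{\lambda\in\widehat G_N}e^{-\frac t2c_2(\lambda)}.$$ Explicitly, with highest weights $\lambda=(\lambda_1,\dots,\lambda_r)$, $r=N$ for $A',A$, $r=(N-1)/2$ for $B$, $r=N/2$ for $C,D$: - $A'$: $\lambda\in\mathbb Z^N$ nonincreasing, $c_2(\lambda)=\frac1N\sum_i\lambda_i(\lambda_i+N+1-2i)$; - $A$: $\lambda\in\mathbb N^N$ nonincreasing with $\lambda_N=0$, $c_2(\lambda)=\frac1N\sum_i\lambda_i(\lambda_i+N+1-2i)-\frac1{N^2}(\sum_i\lambda_i)^2$; - $B$: $\lambda\in\mathbb N^r$ nonincreasing, $c_2(\lambda)=\frac1N\sum_i\lambda_i(\lambda_i+N-2i)$; - $C$: $\lambda\in\mathbb N^r$ nonincreasing, $c_2(\lambda)=\frac1N\sum_i\lambda_i(\lambda_i+N+2-2i)$; - $D$: $\lambda\in\mathbb N^{r-1}\times\mathbb Z$ with $\lambda_1\ge\dots\ge\lambda_{r-1}\ge|\lambda_r|$, $c_2(\lambda)=\frac1N\sum_i\lambda_i(\lambda_i+N-2i)$. ($\mathbb N$ contains $0$.) **Partitions.** An integer partition $\alpha=(\alpha_1\ge\dots\ge\alpha_{\ell})$ is a finite nonincreasing family of positive integers (possibly empty), $|\alpha|=\sum\alpha_i$, $\ell(\alpha)=\ell$. Its total content is $K(\alpha)=\sum_{\square}(j(\square)-i(\square))=\frac12\sum_{i}\alpha_i(\alpha_i+1-2i)$ (sum over cells of the Young diagram, $i$ row, $j$ column). For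 $q\in(0,1)$: $\phi(q)=\prod_{m\ge1}(1-q^m)$, $\theta(q)=\sum_{n\in\mathbb Z}q^{n^2}$. The $q$-uniform measure on all partitions is $\mathbb P(\alpha)=\phi(q)q^{|\alpha|}$; the integer Gaussian distribution with parameter $q$ is $\mathbb P(n)=\theta(q)^{-1}q^{n^2}$ on $\mathbb Z$. **Notation.** $f(t,N)=O_t(g(t,N))$ as $N\to\infty$ means: for every $t>0$ there are a constant $C(t)$ and an integer $N_0$ (which may depend on the other fixed parameters such as $p$) such that $|f(t,N)|\le C(t)|g(t,N)|$ for all $N\ge N_0$. The coefficients depend on $t$ and on the type, not on $N$ or $p$. *)

theory Defs
  imports "HOL-Probability.Probability" "HOL-Library.Landau_Symbols"
begin

section \<open>The central heat trace of a compact classical group\<close>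

datatype classical_type = Type_A' | Type_A | Type_B | Type_C | Type_D

text \<open>The matrix sizes \<open>N\<close> for which \<open>G\<^sub>N \<subseteq> GL\<^sub>N(\<complex>)\<close> exists:
  \<open>U(N)\<close>, \<open>SU(N)\<close>, \<open>SO(N)\<close> with \<open>N\<close> odd, \<open>Sp(N/2)\<close> with \<open>N\<close> even, \<open>SO(N)\<close> with \<open>N\<close> even.\<close>

fun admissible :: "classical_type \<Rightarrow> nat \<Rightarrow> bool" where
  "admissible Type_A' N \<longleftrightarrow> N \<ge> 1"
| "admissible Type_A N \<longleftrightarrow> N \<ge> 1"
| "admissible Type_B N \<longleftrightarrow> odd N"
| "admissible Type_C N \<longleftrightarrow> even N \<and> N \<ge> 2"
| "admissible Type_D N \<longleftrightarrow> even N \<and> N \<ge> 2"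

definition along :: "classical_type \<Rightarrow> nat filter" where
  "along \<tau> = inf sequentially (principal {N. admissible \<tau> N})"

text \<open>\<open>dual \<tau> N\<close> is the set of irreducible representations of \<open>G\<^sub>N\<close>, each given by its highest
  weight \<open>(\<lambda>\<^sub>1, \<dots>, \<lambda>\<^sub>r)\<close>, an integer list of length \<open>r\<close>.  For \<open>SU(N)\<close> the list has length \<open>N\<close>
  and is normalised by \<open>\<lambda>\<^sub>N = 0\<close>.  In type \<open>D\<close> the condition reads
  \<open>\<lambda>\<^sub>1 \<ge> \<dots> \<ge> \<lambda>\<^bsub>r-1\<^esub> \<ge> \<bar>\<lambda>\<^sub>r\<bar>\<close>, so all entries but the last are nonnegative.\<close>

fun weight_length :: "classical_type \<Rightarrow> nat \<Rightarrow> nat" where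
  "weight_length Type_A' N = N"
| "weight_length Type_A N = N"
| "weight_length Type_B N = (N - 1) div 2"
| "weight_length Type_C N = N div 2"
| "weight_length Type_D N = N div 2"

fun dominant :: "classical_type \<Rightarrow> int list \<Rightarrow> bool" where
  "dominant Type_A' l \<longleftrightarrow> sorted_wrt (\<ge>) l"
| "dominant Type_A l \<longleftrightarrow> sorted_wrt (\<ge>) l \<and> (\<forall>x\<in>set l. x \<ge> 0) \<and> last l = 0"
| "dominant Type_B l \<longleftrightarrow> sorted_wrt (\<ge>) l \<and> (\<forall>x\<in>set l. x \<ge> 0)"
| "dominant Type_C l \<longleftrightarrow> sorted_wrt (\<ge>) l \<and> (\<forall>x\<in>set l. x \<ge> 0)"
| "dominant Type_D l \<longleftrightarrow> sorted_wrt (\<ge>) (butlast l @ [\<bar>last l\<bar>])"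

definition dual :: "classical_type \<Rightarrow> nat \<Rightarrow> int list set" where
  "dual \<tau> N = {l. length l = weight_length \<tau> N \<and> dominant \<tau> l}"

text \<open>The \<open>i\<close>-th entry \<open>\<lambda>\<^sub>i\<close>, counted from \<open>1\<close>.\<close>

definition entry :: "int list \<Rightarrow> nat \<Rightarrow> real" where
  "entry l i = real_of_int (l ! (i - 1))"

text \<open>The eigenvalue of \<open>- \<Delta>\<close> on the character with highest weight \<open>\<lambda>\<close>, for the inner product
  \<open>c\<^sub>N Tr(X\<^sup>* Y)\<close> on the Lie algebra with \<open>c\<^sub>N = N\<close> in types \<open>A', A\<close> and \<open>c\<^sub>N = N/2\<close> in types
  \<open>B, C, D\<close>.\<close>

fun c2 :: "classical_type \<Rightarrow> nat \<Rightarrow> int list \<Rightarrow> real" where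
  "c2 Type_A' N l =
     (\<Sum>i = 1..N. entry l i * (entry l i + real N + 1 - 2 * real i)) / real N"
| "c2 Type_A N l =
     (\<Sum>i = 1..N. entry l i * (entry l i + real N + 1 - 2 * real i)) / real N
     - (\<Sum>i = 1..N. entry l i)\<^sup>2 / (real N)\<^sup>2"
| "c2 Type_B N l =
     (\<Sum>i = 1..weight_length Type_B N. entry l i * (entry l i + real N - 2 * real i)) / real N"
| "c2 Type_C N l =
     (\<Sum>i = 1..weight_length Type_C N. entry l i * (entry l i + real N + 2 - 2 * real i)) / real N"
| "c2 Type_D N l =
     (\<Sum>i = 1..weight_length Type_D N. entry l i * (entry l i + real N - 2 * real i)) / real N"

text \<open>The trace of \<open>exp(t/2 \<Delta>)\<close> on square-integrable central functions: the irreducible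
  characters form an orthonormal basis of eigenvectors.\<close>

definition heat_trace :: "classical_type \<Rightarrow> nat \<Rightarrow> real \<Rightarrow> real" where
  "heat_trace \<tau> N t = (\<Sum>\<^sub>\<infinity>l\<in>dual \<tau> N. exp (- t / 2 * c2 \<tau> N l))"

section \<open>Random partitions\<close>

definition is_partition :: "nat list \<Rightarrow> bool" where
  "is_partition \<alpha> \<longleftrightarrow> sorted_wrt (\<ge>) \<alpha> \<and> (\<forall>x\<in>set \<alpha>. x \<ge> 1)"

definition total_content :: "nat list \<Rightarrow> int" where
  "total_content \<alpha> = (\<Sum>i = 1..length \<alpha>. \<Sum>j = 1..\<alpha> ! (i - 1). int j - int i)"

abbreviation K :: "nat list \<Rightarrow> real" where
  "K \<alpha> \<equiv> real_of_int (total_content \<alpha>)"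

abbreviation weight :: "nat list \<Rightarrow> real" where
  "weight \<alpha> \<equiv> real (sum_list \<alpha>)"

definition \<phi> :: "real \<Rightarrow> real" where
  "\<phi> q = (\<Prod>m. 1 - q ^ Suc m)"

definition \<theta> :: "real \<Rightarrow> real" where
  "\<theta> q = (\<Sum>\<^sub>\<infinity>n::int. q powi n\<^sup>2)"

text \<open>Both are probability distributions for \<open>0 < q < 1\<close>, the first one by Euler's product
  formula; otherwise \<open>embed_pmf\<close> returns an unspecified distribution.\<close>

definition q_uniform :: "real \<Rightarrow> nat list pmf" where
  "q_uniform q = embed_pmf (\<lambda>\<alpha>. if is_partition \<alpha> then \<phi> q * q ^ sum_list \<alpha> else 0)"

definition integer_gaussian :: "real \<Rightarrow> int pmf" where
  "integer_gaussian q = embed_pmf (\<lambda>n. q powi n\<^sup>2 / \<theta> q)"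

section \<open>The coefficients\<close>

definition q_of :: "real \<Rightarrow> real" where
  "q_of t = exp (- t / 2)"

text \<open>\<open>even_coeff_A' k\<close> and \<open>even_coeff_A k\<close> are the coefficients of \<open>N\<^bsup>-2k\<^esup>\<close>.  Independence of the
  random variables is expressed by product distributions.\<close>

definition even_coeff_A' :: "nat \<Rightarrow> real \<Rightarrow> real" where
  "even_coeff_A' k t =
     \<theta> (q_of t) * t ^ (2 * k) / ((\<phi> (q_of t))\<^sup>2 * fact (2 * k)) *
     measure_pmf.expectation
       (pair_pmf (q_uniform (q_of t)) (pair_pmf (q_uniform (q_of t)) (integer_gaussian (q_of t))))
       (\<lambda>(\<alpha>, \<beta>, n). (K \<alpha> + K \<beta> + real_of_int n * (weight \<alpha> - weight \<beta>)) ^ (2 * k))"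

definition even_coeff_A :: "nat \<Rightarrow> real \<Rightarrow> real" where
  "even_coeff_A k t =
     1 / (\<phi> (q_of t))\<^sup>2 *
     (\<Sum>(k1, k2, k3) \<in> {(k1, k2, k3). k1 + k2 + k3 = k}.
        t ^ (2 * k - k3) *
        measure_pmf.expectation (pair_pmf (q_uniform (q_of t)) (q_uniform (q_of t)))
          (\<lambda>(\<alpha>, \<beta>). K \<alpha> ^ (2 * k1) * K \<beta> ^ (2 * k2) * (weight \<alpha> - weight \<beta>) ^ (2 * k3)) /
        (2 ^ k3 * fact (2 * k1) * fact (2 * k2) * fact k3))"

definition coeff_BD :: "nat \<Rightarrow> real \<Rightarrow> real" where
  "coeff_BD k t =
     (- t) ^ k / (\<phi> (q_of t) * fact k) *
     measure_pmf.expectation (q_uniform (q_of t)) (\<lambda>\<alpha>. (K \<alpha> - weight \<alpha> / 2) ^ k)"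

definition coeff_C :: "nat \<Rightarrow> real \<Rightarrow> real" where
  "coeff_C k t =
     (- t) ^ k / (\<phi> (q_of t) * fact k) *
     measure_pmf.expectation (q_uniform (q_of t)) (\<lambda>\<alpha>. (K \<alpha> + weight \<alpha> / 2) ^ k)"

end

theory Submission imports Defs begin

text \<open>Highest weights are encoded by partitions of bounded length: one partition for types
  \<open>B\<close>, \<open>C\<close>, \<open>D\<close>, and two partitions \<open>\<alpha>\<close>, \<open>\<beta>\<close> (the excess above and the defect below the middle entry
  \<open>n\<close>) for types \<open>A'\<close>, \<open>A\<close>.  In this encoding the eigenvalue is the size \<open>M\<close> of the data plus
  corrections of order \<open>1/N\<close> and \<open>1/N\<^sup>2\<close> given by contents, so that each term of the trace is
  \<open>exp (- t M / 2 + a / N + b / N\<^sup>2)\<close> with \<open>a\<close>, \<open>b\<close> polynomially bounded in \<open>M\<close>.  Chebyshev's sum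
  inequality bounds the content from below by \<open>- l \<bar>\<alpha>\<bar> / 2\<close>, where the length \<open>l\<close> is at most \<open>N / 2\<close>;
  hence the exponent is at most \<open>- t M / 4\<close> uniformly in \<open>N\<close>, Taylor's formula may be summed term by
  term, and partitions that are too long contribute \<open>O(N\<^sup>-\<^sup>k)\<close> for all \<open>k\<close> since they satisfy
  \<open>N \<le> 2 M\<close>.  Odd-order terms in types \<open>A'\<close>, \<open>A\<close> vanish because conjugating a partition negates its
  content, and Euler's product formula identifies the sums with expectations.\<close>

section \<open>Two-scale expansion of exponential sums\<close>

text \<open>The obstacle is uniformity in \<open>N\<close>. Contents grow quadratically in the size,
  so \<open>K / N\<close> is not small against \<open>M\<close> once \<open>M\<close> is comparable
  with \<open>N\<close>. A large positive content only adds damping; a very negative one is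
  dangerous. Hence all estimates bound the exponent from above and never its absolute value. This
  also dictates the pivot in types \<open>A'\<close> and \<open>A\<close>. Partitions of length up
  to \<open>N\<close> would let the content bound consume the whole rate \<open>t / 2\<close>;
  measuring a weight from its middle entry keeps both lengths within \<open>N / 2\<close>, and half
  of the rate survives. In these types
  \<open>n (\<bar>\<alpha>\<bar> - \<bar>\<beta>\<bar>) / N\<close> and \<open>(\<bar>\<alpha>\<bar>
  - \<bar>\<beta>\<bar>)\<^sup>2 / N\<^sup>2\<close> are of second degree in the data as well. They
  are paid for by the sum of squares of the parts that Chebyshev's inequality leaves over, which
  Cauchy-Schwarz bounds below by \<open>2 \<bar>\<alpha>\<bar>\<^sup>2 / N\<close>. In type
  \<open>D\<close> the weights with negative last entry mirror those with positive last entry, hence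
  partitions of maximal length; these are so large that their contribution is invisible at every
  order.\<close>

lemma exp_taylor_bound:
  fixes u :: real
  shows "\<bar>exp u - (\<Sum>k\<le>m. u ^ k / fact k)\<bar> \<le> \<bar>u\<bar> ^ Suc m * max 1 (exp u)"
proof -
  \<comment> \<open>The intermediate point must stay below \<open>max 0 u\<close>, so that the
    remainder carries \<open>max 1 (exp u)\<close> and not \<open>exp \<bar>u\<bar>\<close>. For
    negative \<open>u\<close> this takes the Maclaurin form with \<open>v < 0\<close>, since
    \<open>\<bar>v\<bar> \<le> \<bar>u\<bar>\<close> alone would admit positive
    \<open>v\<close>.\<close>
  have "\<exists>v\<le>max 0 u. exp u = (\<Sum>k<Suc m. u ^ k / fact k) + exp v / fact (Suc m) * u ^ Suc m"
  proof (cases "u < 0")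
    case True
    then obtain v where "u < v" "v < 0" "exp u = (\<Sum>k<Suc m. exp 0 / fact k * u ^ k) + exp v / fact (Suc m) * u ^ Suc m"
      using Maclaurin_minus[of u "Suc m" "\<lambda>_. exp" exp] by (auto simp: DERIV_exp)
    then show ?thesis by (intro exI[of _ v]) auto
  next
    case False
    obtain v where "\<bar>v\<bar> \<le> \<bar>u\<bar>" "exp u = (\<Sum>k<Suc m. u ^ k / fact k) + exp v / fact (Suc m) * u ^ Suc m"
      using Maclaurin_exp_le[of u "Suc m"] by blast
    with False show ?thesis by (intro exI[of _ v]) auto
  qed
  then obtain v where v: "v \<le> max 0 u"
    "exp u = (\<Sum>k<Suc m. u ^ k / fact k) + exp v / fact (Suc m) * u ^ Suc m" by blast
  have "exp v / fact (Suc m) \<le> exp v"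
    using fact_ge_1[of "Suc m", where ?'a = real]
    by (simp add: divide_le_eq mult_le_cancel_left1 del: fact_Suc)
  also have "exp v \<le> max 1 (exp u)"
    using v(1) by (simp add: max_def split: if_splits)
  finally have "exp v / fact (Suc m) \<le> max 1 (exp u)" .
  then have "\<bar>u\<bar> ^ Suc m * (exp v / fact (Suc m)) \<le> \<bar>u\<bar> ^ Suc m * max 1 (exp u)"
    by (intro mult_left_mono) auto
  moreover have "\<bar>exp u - (\<Sum>k\<le>m. u ^ k / fact k)\<bar> = \<bar>u\<bar> ^ Suc m * (exp v / fact (Suc m))"
    unfolding v(2) lessThan_Suc_atMost by (simp add: abs_mult power_abs mult_ac del: fact_Suc power_Suc)
  ultimately show ?thesis by simp
qed

lemma power_add_div_fact:
  fixes x y :: real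
  shows "(x + y) ^ n / fact n = (\<Sum>i\<le>n. (x ^ i / fact i) * (y ^ (n - i) / fact (n - i)))"
  using exp_series_add_commuting[of x y n] by (simp add: divide_inverse mult_ac)

lemma finite_triangle: "finite {(i, j). i + 2 * j \<le> (m::nat)}" "finite {(i, j). i + j \<le> (m::nat)}"
  by (rule finite_subset[of _ "{..m} \<times> {..m}"], auto)+

text \<open>In the application \<open>h = 1 / N\<close>. The Taylor polynomial of degree
  \<open>m\<close> in \<open>a * h + b * h\<^sup>2\<close> consists of the monomials with
  \<open>i + j \<le> m\<close>; those with \<open>i + 2 * j > m\<close> have order at least
  \<open>h ^ Suc m\<close> and move to the error. Thus \<open>2 ^ Suc m\<close> comes from the
  Taylor remainder and the cardinality from the moved monomials.\<close>

lemma exp_two_scale_bound: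
  fixes a b h R :: real
  assumes h: "0 \<le> h" "h \<le> 1" and R: "1 \<le> R" "\<bar>a\<bar> \<le> R" "\<bar>b\<bar> \<le> R"
  shows "\<bar>exp (a * h + b * h\<^sup>2) - (\<Sum>(i, j) | i + 2 * j \<le> m. a ^ i / fact i * (b ^ j / fact j) * h ^ (i + 2 * j))\<bar>
    \<le> (2 ^ Suc m + real (card {(i, j). i + j \<le> m})) * R ^ Suc m * h ^ Suc m * max 1 (exp (a * h + b * h\<^sup>2))"
proof -
  define u where "u = a * h + b * h\<^sup>2"
  define g where "g = (\<lambda>i j. a ^ i / fact i * (b ^ j / fact j) * h ^ (i + 2 * j))"
  define X where "X = {(i, j). i + j \<le> m}"
  define Y where "Y = {(i, j). i + 2 * j \<le> m}"
  have fin: "finite X" "finite Y" and sub: "Y \<subseteq> X"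
    using finite_triangle by (auto simp: X_def Y_def)
  have bh: "\<bar>b\<bar> * h\<^sup>2 \<le> R * h"
    using h R power_le_one[of h 1] by (intro mult_mono) (auto simp: power2_eq_square mult_left_le)
  have "\<bar>u\<bar> \<le> \<bar>a\<bar> * h + \<bar>b\<bar> * h\<^sup>2"
    using h by (auto simp: u_def abs_mult intro: order_trans[OF abs_triangle_ineq])
  also have "\<dots> \<le> 2 * R * h"
    using bh h R mult_right_mono[of "\<bar>a\<bar>" R h] by linarith
  finally have u: "\<bar>u\<bar> \<le> 2 * R * h" .
  have "\<bar>exp u - (\<Sum>k\<le>m. u ^ k / fact k)\<bar> \<le> \<bar>u\<bar> ^ Suc m * max 1 (exp u)"
    by (rule exp_taylor_bound)
  also have "\<dots> \<le> (2 * R * h) ^ Suc m * max 1 (exp u)"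
    by (intro mult_right_mono power_mono u) auto
  finally have 1: "\<bar>exp u - (\<Sum>k\<le>m. u ^ k / fact k)\<bar> \<le> 2 ^ Suc m * R ^ Suc m * h ^ Suc m * max 1 (exp u)"
    by (simp only: power_mult_distrib)
  have "(\<Sum>k\<le>m. u ^ k / fact k) = (\<Sum>k\<le>m. \<Sum>i\<le>k. g i (k - i))"
    unfolding u_def power_add_div_fact g_def
    by (intro sum.cong refl) (simp add: power_mult_distrib power_add power_mult)
  also have "\<dots> = (\<Sum>(i, j)\<in>X. g i j)"
    unfolding X_def by (rule sum.triangle_reindex_eq [symmetric])
  also have "\<dots> = (\<Sum>(i, j)\<in>Y. g i j) + (\<Sum>(i, j)\<in>X - Y. g i j)"
    using sum.subset_diff[OF sub fin(1), of "\<lambda>(i, j). g i j"] by simp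
  finally have 2: "(\<Sum>k\<le>m. u ^ k / fact k) = (\<Sum>(i, j)\<in>Y. g i j) + (\<Sum>(i, j)\<in>X - Y. g i j)" .
  have g_le: "\<bar>g i j\<bar> \<le> R ^ Suc m * h ^ Suc m" if "(i, j) \<in> X - Y" for i j
  proof -
    have "\<bar>a\<bar> ^ i / fact i \<le> R ^ i / 1" "\<bar>b\<bar> ^ j / fact j \<le> R ^ j / 1"
      using R by (intro frac_le power_mono; simp)+
    then have "\<bar>a\<bar> ^ i / fact i * (\<bar>b\<bar> ^ j / fact j) \<le> R ^ i * R ^ j"
      using R by (intro mult_mono) auto
    also have "\<dots> \<le> R ^ Suc m"
      unfolding power_add[symmetric] using R that by (intro power_increasing) (auto simp: X_def)
    finally have "\<bar>a\<bar> ^ i / fact i * (\<bar>b\<bar> ^ j / fact j) \<le> R ^ Suc m" .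
    moreover have "h ^ (i + 2 * j) \<le> h ^ Suc m"
      using h that by (intro power_decreasing) (auto simp: Y_def)
    ultimately have "\<bar>a\<bar> ^ i / fact i * (\<bar>b\<bar> ^ j / fact j) * h ^ (i + 2 * j) \<le> R ^ Suc m * h ^ Suc m"
      using h R by (intro mult_mono) auto
    then show ?thesis
      using h by (simp add: g_def abs_mult power_abs)
  qed
  have "\<bar>\<Sum>(i, j)\<in>X - Y. g i j\<bar> \<le> (\<Sum>p\<in>X - Y. R ^ Suc m * h ^ Suc m)"
    by (rule order_trans[OF sum_abs sum_mono]) (use g_le in auto)
  also have "\<dots> \<le> real (card X) * (R ^ Suc m * h ^ Suc m) * 1"
    using h R card_mono[OF fin(1), of "X - Y"] by (simp add: mult_right_mono)
  also have "\<dots> \<le> real (card X) * (R ^ Suc m * h ^ Suc m) * max 1 (exp u)"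
    using h R by (intro mult_left_mono) auto
  finally have "\<bar>exp u - (\<Sum>(i, j)\<in>Y. g i j)\<bar> \<le> 2 ^ Suc m * R ^ Suc m * h ^ Suc m * max 1 (exp u)
      + real (card X) * (R ^ Suc m * h ^ Suc m) * max 1 (exp u)"
    using 1 2 by linarith
  then show ?thesis
    unfolding u_def g_def X_def Y_def by (simp add: algebra_simps del: power_Suc)
qed

text \<open>Serves the indices that occur in the limiting sum but not in the trace for the given
  \<open>N\<close>: there the truncated expansion is itself the error, and a crude bound on its size
  suffices.\<close>

lemma two_scale_terms_bound:
  fixes a b h R :: real
  assumes h: "0 \<le> h" "h \<le> 1" and R: "1 \<le> R" "\<bar>a\<bar> \<le> R" "\<bar>b\<bar> \<le> R"
  shows "\<bar>\<Sum>(i, j) | i + 2 * j \<le> m. a ^ i / fact i * (b ^ j / fact j) * h ^ (i + 2 * j)\<bar>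
    \<le> real (card {(i, j). i + j \<le> m}) * R ^ m"
proof -
  have g_le: "\<bar>a ^ i / fact i * (b ^ j / fact j) * h ^ (i + 2 * j)\<bar> \<le> R ^ m" if "i + 2 * j \<le> m" for i j
  proof -
    have "\<bar>a\<bar> ^ i / fact i \<le> R ^ i / 1" "\<bar>b\<bar> ^ j / fact j \<le> R ^ j / 1"
      using R by (intro frac_le power_mono; simp)+
    then have "\<bar>a\<bar> ^ i / fact i * (\<bar>b\<bar> ^ j / fact j) \<le> R ^ i * R ^ j"
      using R by (intro mult_mono) auto
    also have "\<dots> \<le> R ^ m"
      unfolding power_add[symmetric] using R that by (intro power_increasing) auto
    finally have "\<bar>a\<bar> ^ i / fact i * (\<bar>b\<bar> ^ j / fact j) \<le> R ^ m" .
    moreover have "h ^ (i + 2 * j) \<le> 1"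
      using h by (intro power_le_one)
    ultimately have "\<bar>a\<bar> ^ i / fact i * (\<bar>b\<bar> ^ j / fact j) * h ^ (i + 2 * j) \<le> R ^ m * 1"
      using h R by (intro mult_mono) auto
    then show ?thesis
      using h by (simp add: abs_mult power_abs)
  qed
  have "\<bar>\<Sum>(i, j) | i + 2 * j \<le> m. a ^ i / fact i * (b ^ j / fact j) * h ^ (i + 2 * j)\<bar>
      \<le> (\<Sum>p | fst p + 2 * snd p \<le> m. R ^ m)"
    unfolding case_prod_unfold by (rule order_trans[OF sum_abs sum_mono]) (use g_le in auto)
  also have "\<dots> \<le> real (card {(i, j). i + j \<le> m}) * R ^ m"
    using R card_mono[OF finite_triangle(2)[of m], of "{(i, j). i + 2 * j \<le> m}"]
    by (auto simp: case_prod_unfold intro!: mult_right_mono card_mono finite_triangle(2)[unfolded case_prod_unfold])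
  finally show ?thesis .
qed

lemma poly_exp_bounded:
  fixes \<epsilon> :: real
  assumes "\<epsilon> > 0"
  obtains C where "C \<ge> 0" "\<And>x. x \<ge> 0 \<Longrightarrow> (1 + x) ^ k \<le> C * exp (\<epsilon> * x)"
proof
  \<comment> \<open>\<open>Suc k\<close> in place of \<open>k\<close> keeps the divisor positive
    when \<open>k = 0\<close>.\<close>
  define n where "n = real (Suc k)"
  have n: "n > 0" "real k \<le> n" by (auto simp: n_def)
  define d where "d = 1 + n / \<epsilon>"
  have d: "0 \<le> d" using assms n by (simp add: d_def)
  then show "0 \<le> d ^ k" by simp
  fix x :: real assume x: "x \<ge> 0"
  define e where "e = \<epsilon> * x / n"
  have e: "e \<ge> 0" using x assms n by (simp add: e_def)
  have "n / \<epsilon> * e = x" using assms n by (simp add: e_def)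
  moreover have "n / \<epsilon> \<ge> 0" using n assms by simp
  ultimately have "1 + x \<le> d * (1 + e)"
    using e by (simp add: d_def distrib_left distrib_right)
  also have "\<dots> \<le> d * exp e"
    using d by (intro mult_left_mono exp_ge_add_one_self)
  finally have "(1 + x) ^ k \<le> (d * exp e) ^ k"
    using x by (intro power_mono) auto
  also have "\<dots> = d ^ k * exp (k * e)"
    by (simp add: power_mult_distrib exp_of_nat_mult)
  also have "\<dots> \<le> d ^ k * exp (\<epsilon> * x)"
  proof -
    have "k * e \<le> n * e"
      using e n by (intro mult_right_mono) auto
    also have "n * e = \<epsilon> * x" using n by (simp add: e_def)
    finally show ?thesis using d by (intro mult_left_mono) auto
  qed
  finally show "(1 + x) ^ k \<le> d ^ k * exp (\<epsilon> * x)" .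
qed

section \<open>Index sets with exponential summability, and expansion term by term\<close>

lemma abs_summable_on_dominated:
  fixes f g :: "'a \<Rightarrow> real"
  assumes "g summable_on A" "\<And>x. x \<in> A \<Longrightarrow> \<bar>f x\<bar> \<le> g x"
  shows "(\<lambda>x. norm (f x)) summable_on A"
  using assms summable_on_iff_abs_summable_on_real[of g A]
  by (intro Infinite_Sum.abs_summable_on_comparison_test'[of g]) auto

lemma has_sum_finite_sum:
  fixes f :: "'i \<Rightarrow> 'a \<Rightarrow> real"
  assumes "finite I" "\<And>i. i \<in> I \<Longrightarrow> (f i has_sum s i) A"
  shows "((\<lambda>x. \<Sum>i\<in>I. f i x) has_sum (\<Sum>i\<in>I. s i)) A"
  using assms by (induction I rule: finite_induct) (auto intro: has_sum_add)

text \<open>\<open>S\<close> collects the data that occur for any \<open>N\<close>, and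
  \<open>M\<close> is their size. Summability is asked for at every positive rate because the Taylor
  estimate leaves only \<open>t / 4\<close> and absorbing polynomial factors halves the rate
  again.\<close>

locale growth =
  fixes S :: "'s set" and M :: "'s \<Rightarrow> real"
  assumes M_nonneg: "s \<in> S \<Longrightarrow> 0 \<le> M s"
    and summable_exp: "0 < \<epsilon> \<Longrightarrow> (\<lambda>s. exp (- \<epsilon> * M s)) summable_on S"
begin

definition poly_bounded :: "('s \<Rightarrow> real) \<Rightarrow> bool" where
  "poly_bounded f \<longleftrightarrow> (\<exists>c k. \<forall>s\<in>S. \<bar>f s\<bar> \<le> c * (1 + M s) ^ k)"

lemma poly_boundedI: "(\<And>s. s \<in> S \<Longrightarrow> \<bar>f s\<bar> \<le> c * (1 + M s) ^ k) \<Longrightarrow> poly_bounded f"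
  unfolding poly_bounded_def by blast

lemma poly_boundedD:
  assumes "poly_bounded f"
  shows "\<exists>c k. c \<ge> 0 \<and> (\<forall>s\<in>S. \<bar>f s\<bar> \<le> c * (1 + M s) ^ k)"
proof -
  obtain c k where *: "\<And>s. s \<in> S \<Longrightarrow> \<bar>f s\<bar> \<le> c * (1 + M s) ^ k"
    using assms unfolding poly_bounded_def by blast
  have "\<bar>f s\<bar> \<le> \<bar>c\<bar> * (1 + M s) ^ k" if "s \<in> S" for s
    by (rule order_trans[OF *[OF that] mult_right_mono]) (use M_nonneg[OF that] in auto)
  then show ?thesis by (intro exI[of _ "\<bar>c\<bar>"] exI[of _ k]) auto
qed

lemma poly_bounded_const: "poly_bounded (\<lambda>_. c)"
  by (rule poly_boundedI[of _ "\<bar>c\<bar>" 0]) simp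

lemma poly_bounded_mult:
  assumes f: "poly_bounded f" and g: "poly_bounded g"
  shows "poly_bounded (\<lambda>s. f s * g s)"
proof -
  obtain c k where c: "c \<ge> 0" "\<forall>s\<in>S. \<bar>f s\<bar> \<le> c * (1 + M s) ^ k"
    using poly_boundedD[OF f] by blast
  obtain d l where d: "d \<ge> 0" "\<forall>s\<in>S. \<bar>g s\<bar> \<le> d * (1 + M s) ^ l"
    using poly_boundedD[OF g] by blast
  show ?thesis
  proof (rule poly_boundedI)
    fix s assume s: "s \<in> S"
    have "\<bar>f s * g s\<bar> \<le> (c * (1 + M s) ^ k) * (d * (1 + M s) ^ l)"
      unfolding abs_mult using bspec[OF c(2) s] bspec[OF d(2) s] c(1) d(1) M_nonneg[OF s] by (intro mult_mono) auto
    also have "\<dots> = (c * d) * (1 + M s) ^ (k + l)"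
      by (simp add: power_add)
    finally show "\<bar>f s * g s\<bar> \<le> (c * d) * (1 + M s) ^ (k + l)" .
  qed
qed

lemma poly_bounded_power: "poly_bounded f \<Longrightarrow> poly_bounded (\<lambda>s. f s ^ n)"
  by (induction n) (auto intro: poly_bounded_mult poly_bounded_const)

lemma poly_bounded_add:
  assumes f: "poly_bounded f" and g: "poly_bounded g"
  shows "poly_bounded (\<lambda>s. f s + g s)"
proof -
  obtain c k where c: "c \<ge> 0" "\<forall>s\<in>S. \<bar>f s\<bar> \<le> c * (1 + M s) ^ k"
    using poly_boundedD[OF f] by blast
  obtain d l where d: "d \<ge> 0" "\<forall>s\<in>S. \<bar>g s\<bar> \<le> d * (1 + M s) ^ l"
    using poly_boundedD[OF g] by blast
  show ?thesis
  proof (rule poly_boundedI)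
    fix s assume s: "s \<in> S"
    have "c * (1 + M s) ^ k \<le> c * (1 + M s) ^ (k + l)" "d * (1 + M s) ^ l \<le> d * (1 + M s) ^ (k + l)"
      using c(1) d(1) M_nonneg[OF s] by (auto intro!: mult_left_mono power_increasing)
    then show "\<bar>f s + g s\<bar> \<le> (c + d) * (1 + M s) ^ (k + l)"
      using bspec[OF c(2) s] bspec[OF d(2) s] unfolding distrib_right by linarith
  qed
qed

lemmas poly_bounded_intros = poly_bounded_const poly_bounded_mult poly_bounded_power poly_bounded_add

lemma summable_exp_poly_bounded:
  assumes "\<epsilon> > 0" "poly_bounded f"
  shows "(\<lambda>s. exp (- \<epsilon> * M s) * f s) summable_on S"
proof -
  obtain c k where c: "c \<ge> 0" "\<forall>s\<in>S. \<bar>f s\<bar> \<le> c * (1 + M s) ^ k"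
    using poly_boundedD[OF assms(2)] by blast
  \<comment> \<open>Half of the rate absorbs the polynomial, the other half keeps the sum
    convergent.\<close>
  obtain C where C: "C \<ge> 0" "\<And>x. x \<ge> 0 \<Longrightarrow> (1 + x) ^ k \<le> C * exp (\<epsilon> / 2 * x)"
    using poly_exp_bounded[of "\<epsilon> / 2" k] assms(1) by (metis half_gt_zero)
  have le: "norm (exp (- \<epsilon> * M s) * f s) \<le> exp (- (\<epsilon> / 2) * M s) * (c * C)" if s: "s \<in> S" for s
  proof -
    have "norm (exp (- \<epsilon> * M s) * f s) \<le> exp (- \<epsilon> * M s) * (c * (1 + M s) ^ k)"
      using bspec[OF c(2) s] by (simp add: abs_mult)
    also have "\<dots> \<le> exp (- \<epsilon> * M s) * (c * (C * exp (\<epsilon> / 2 * M s)))"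
      using C(2)[OF M_nonneg[OF s]] c(1) by (intro mult_left_mono) auto
    also have "\<dots> = (exp (- \<epsilon> * M s) * exp (\<epsilon> / 2 * M s)) * (c * C)"
      by (simp add: mult_ac)
    also have "exp (- \<epsilon> * M s) * exp (\<epsilon> / 2 * M s) = exp (- (\<epsilon> / 2) * M s)"
      by (simp add: exp_add[symmetric] algebra_simps)
    finally show ?thesis .
  qed
  have "(\<lambda>s. exp (- (\<epsilon> / 2) * M s) * (c * C)) summable_on S"
    using summable_exp[of "\<epsilon> / 2"] assms by (intro summable_on_cmult_left) auto
  from abs_summable_summable[OF abs_summable_on_dominated[OF this]] le show ?thesis
    by simp
qed

text \<open>\<open>D N\<close> is the part of \<open>S\<close> realised at size \<open>N\<close>,
  and \<open>P\<close> selects the admissible sizes. By \<open>ins\<close> the exponential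
  correction costs at most half of the rate, uniformly in \<open>N\<close>; by \<open>out\<close> a
  missing index has size comparable with \<open>N\<close>, so that any power of \<open>1 / N\<close>
  can be bought with the same power of its size. The error of each term is then at most
  \<open>B s / N ^ Suc m\<close> with a summable \<open>B\<close>.\<close>

theorem two_scale_expansion:
  fixes a b :: "'s \<Rightarrow> real" and D :: "nat \<Rightarrow> 's set" and P :: "nat \<Rightarrow> bool"
  assumes t: "t > 0"
    and a: "poly_bounded a" and b: "poly_bounded b"
    and sub: "\<And>N. D N \<subseteq> S"
    and out: "\<And>N s. P N \<Longrightarrow> s \<in> S \<Longrightarrow> s \<notin> D N \<Longrightarrow> real N \<le> 2 * (1 + M s)"
    and ins: "\<And>N s. P N \<Longrightarrow> N > 0 \<Longrightarrow> s \<in> D N \<Longrightarrow> a s / real N + b s / (real N)\<^sup>2 \<le> t / 4 * M s"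
    and T: "\<And>N. P N \<Longrightarrow> N > 0 \<Longrightarrow> T N = (\<Sum>\<^sub>\<infinity>s\<in>D N. exp (- t / 2 * M s + a s / real N + b s / (real N)\<^sup>2))"
  shows "(\<lambda>N. T N - (\<Sum>(i, j) | i + 2 * j \<le> m.
      (\<Sum>\<^sub>\<infinity>s\<in>S. exp (- t / 2 * M s) * (a s ^ i / fact i * (b s ^ j / fact j))) / real N ^ (i + 2 * j)))
    \<in> O[inf sequentially (principal {N. P N})](\<lambda>N. 1 / real N ^ Suc m)"
proof -
  define w where "w = (\<lambda>s. exp (- t / 2 * M s))"
  define g where "g = (\<lambda>i j s. a s ^ i / fact i * (b s ^ j / fact j))"
  \<comment> \<open>Squares instead of absolute values keep \<open>R\<close> within the closure
    rules for \<open>poly_bounded\<close>. The summand \<open>2 * (1 + M s)\<close> ensures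
    \<open>N \<le> R s\<close> outside \<open>D N\<close>.\<close>
  define R where "R = (\<lambda>s. 2 * (1 + M s) + (a s)\<^sup>2 + (b s)\<^sup>2)"
  define X where "X = {(i, j). i + j \<le> m}"
  define Y where "Y = {(i, j). i + 2 * j \<le> m}"
  define C where "C = 2 ^ Suc m + real (card X)"
  \<comment> \<open>The first power of \<open>R s\<close> measures the expansion; the second is the
    price of the factor \<open>(R s * h) ^ Suc m \<ge> 1\<close> inserted outside
    \<open>D N\<close>. Inside \<open>D N\<close> it is harmless because
    \<open>R s \<ge> 1\<close>.\<close>
  define B where "B = (\<lambda>s. exp (- t / 4 * M s) * (C * R s ^ Suc m * R s ^ Suc m))"
  have C: "C \<ge> 0" by (simp add: C_def)
  have sq: "\<bar>x\<bar> \<le> 1 + x\<^sup>2" for x :: real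
    using zero_le_power2[of "\<bar>x\<bar> - 1"] by (simp add: power2_diff)
  have R: "1 \<le> R s \<and> \<bar>a s\<bar> \<le> R s \<and> \<bar>b s\<bar> \<le> R s \<and> 2 * (1 + M s) \<le> R s" if "s \<in> S" for s
    using M_nonneg[OF that] sq[of "a s"] sq[of "b s"] zero_le_power2[of "a s"] zero_le_power2[of "b s"]
    unfolding R_def by auto
  then have R1: "1 \<le> R s" and Ra: "\<bar>a s\<bar> \<le> R s" and Rb: "\<bar>b s\<bar> \<le> R s" and RM: "2 * (1 + M s) \<le> R s"
    if "s \<in> S" for s
    using that by blast+
  have poly_M: "poly_bounded (\<lambda>s. 1 + M s)"
    by (rule poly_boundedI[of _ 1 1]) (use M_nonneg in force)
  have "poly_bounded (\<lambda>s. C * R s ^ Suc m * R s ^ Suc m)"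
    unfolding R_def power2_eq_square
    by (intro poly_bounded_mult poly_bounded_power poly_bounded_add poly_bounded_const poly_M a b)
  then have sumB: "B summable_on S"
    using summable_exp_poly_bounded[of "t / 4"] t by (simp add: B_def)
  have "poly_bounded (g i j)" for i j
    unfolding g_def divide_inverse
    by (intro poly_bounded_mult poly_bounded_power poly_bounded_const a b)
  from summable_exp_poly_bounded[OF _ this, of "t / 2"] t
  have sumg: "(\<lambda>s. w s * g i j s) summable_on S" for i j
    by (simp add: w_def)
  have bound: "\<bar>T N - (\<Sum>(i, j)\<in>Y. (\<Sum>\<^sub>\<infinity>s\<in>S. w s * g i j s) / real N ^ (i + 2 * j))\<bar>
      \<le> (\<Sum>\<^sub>\<infinity>s\<in>S. B s) * \<bar>1 / real N ^ Suc m\<bar>"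
    if N: "P N" "N > 0" for N
  proof -
    define h where "h = 1 / real N"
    have h: "0 \<le> h" "h \<le> 1" using N by (auto simp: h_def)
    \<comment> \<open>Extension by zero puts the trace and its expansion on the same index set, so
      that missing indices become termwise errors like all others.\<close>
    define F where "F = (\<lambda>s. if s \<in> D N then w s * exp (a s * h + b s * h\<^sup>2) else 0)"
    define G where "G = (\<lambda>s. \<Sum>(i, j)\<in>Y. g i j s * h ^ (i + 2 * j))"
    have TF: "T N = (\<Sum>\<^sub>\<infinity>s\<in>S. F s)"
      unfolding T[OF N] F_def using sub[of N]
      by (intro infsum_cong_neutral) (auto simp: w_def h_def exp_add[symmetric] power_divide add_ac)
    have wB: "w s \<le> exp (- t / 4 * M s)" if "s \<in> S" for s
      using M_nonneg[OF that] t by (simp add: w_def mult_right_mono)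
    have FB: "\<bar>F s - w s * G s\<bar> \<le> B s * h ^ Suc m" if s: "s \<in> S" for s
    proof (cases "s \<in> D N")
      case True
      define u where "u = a s * h + b s * h\<^sup>2"
      have "\<bar>exp u - G s\<bar> \<le> C * R s ^ Suc m * h ^ Suc m * max 1 (exp u)"
        using exp_two_scale_bound[OF h R1[OF s] Ra[OF s] Rb[OF s], of m]
        by (simp add: u_def G_def g_def C_def X_def Y_def)
      then have "w s * \<bar>exp u - G s\<bar> \<le> w s * (C * R s ^ Suc m * h ^ Suc m * max 1 (exp u))"
        by (intro mult_left_mono) (simp_all add: w_def)
      also have "\<dots> = (w s * max 1 (exp u)) * (C * R s ^ Suc m) * h ^ Suc m"
        by (simp only: mult_ac)
      also have "w s * max 1 (exp u) \<le> exp (- t / 4 * M s)"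
      proof -
        have "w s * exp u \<le> exp (- t / 4 * M s)"
        proof -
          have "u \<le> t / 4 * M s"
            using ins[OF N True] by (simp add: u_def h_def power_divide)
          then have "- t / 2 * M s + u \<le> - t / 4 * M s" by (simp add: field_simps)
          then show ?thesis by (simp add: w_def exp_add[symmetric])
        qed
        then show ?thesis using wB[OF s] by (simp add: max_def)
      qed
      then have "(w s * max 1 (exp u)) * (C * R s ^ Suc m) * h ^ Suc m
          \<le> exp (- t / 4 * M s) * (C * R s ^ Suc m) * h ^ Suc m"
        using h C R1[OF s] by (intro mult_right_mono) auto
      also have "\<dots> \<le> B s * h ^ Suc m"
      proof -
        have "C * R s ^ Suc m * 1 \<le> C * R s ^ Suc m * R s ^ Suc m"
          using C R1[OF s] by (intro mult_left_mono one_le_power mult_nonneg_nonneg) auto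
        then have "C * R s ^ Suc m \<le> C * R s ^ Suc m * R s ^ Suc m" by simp
        from mult_left_mono[OF this, of "exp (- t / 4 * M s)"] show ?thesis
          unfolding B_def using h by (intro mult_right_mono) (simp_all del: power_Suc)
      qed
      finally have "w s * \<bar>exp u - G s\<bar> \<le> B s * h ^ Suc m" .
      moreover have "F s - w s * G s = w s * (exp u - G s)" "0 \<le> w s"
        using True by (auto simp: F_def u_def algebra_simps w_def)
      ultimately show ?thesis by (simp add: abs_mult)
    next
      case False
      have "real N * h = 1" using N by (simp add: h_def)
      moreover have "real N * h \<le> R s * h"
        using out[OF N(1) s False] RM[OF s] h(1) by (intro mult_right_mono) auto
      ultimately have "1 \<le> R s * h" by simp
      then have 1: "1 \<le> (R s * h) ^ Suc m" by (rule one_le_power)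
      have "\<bar>G s\<bar> \<le> real (card X) * R s ^ m"
        using two_scale_terms_bound[OF h R1[OF s] Ra[OF s] Rb[OF s], of m]
        by (simp add: G_def g_def X_def Y_def)
      also have "\<dots> \<le> C * R s ^ Suc m"
        using R1[OF s] by (intro mult_mono power_increasing) (auto simp: C_def)
      also have "\<dots> \<le> C * R s ^ Suc m * (R s * h) ^ Suc m"
        using mult_left_mono[OF 1, of "C * R s ^ Suc m"] C R1[OF s] by simp
      finally have "w s * \<bar>G s\<bar> \<le> exp (- t / 4 * M s) * (C * R s ^ Suc m * (R s * h) ^ Suc m)"
        using wB[OF s] by (intro mult_mono) auto
      also have "\<dots> = B s * h ^ Suc m"
        by (simp add: B_def power_mult_distrib mult_ac del: power_Suc)
      finally show ?thesis
        using False by (simp add: F_def abs_mult w_def)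
    qed
    have finY: "finite Y" using finite_triangle by (simp add: Y_def)
    have wG: "w s * G s = (\<Sum>p\<in>Y. w s * g (fst p) (snd p) s * h ^ (fst p + 2 * snd p))" for s
      by (simp add: G_def sum_distrib_left case_prod_unfold mult_ac)
    have "((\<lambda>s. w s * G s) has_sum (\<Sum>p\<in>Y. (\<Sum>\<^sub>\<infinity>s\<in>S. w s * g (fst p) (snd p) s) * h ^ (fst p + 2 * snd p))) S"
      unfolding wG by (intro has_sum_finite_sum finY has_sum_cmult_left has_sum_infsum sumg)
    then have sumG: "(\<lambda>s. w s * G s) summable_on S"
      and G: "(\<Sum>\<^sub>\<infinity>s\<in>S. w s * G s) = (\<Sum>(i, j)\<in>Y. (\<Sum>\<^sub>\<infinity>s\<in>S. w s * g i j s) / real N ^ (i + 2 * j))"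
      by (auto simp: has_sum_iff case_prod_unfold h_def power_divide)
    have sumBh: "(\<lambda>s. B s * h ^ Suc m) summable_on S"
      by (intro summable_on_cmult_left sumB)
    have absD: "(\<lambda>s. norm (F s - w s * G s)) summable_on S"
      by (rule abs_summable_on_dominated[OF sumBh]) (use FB in auto)
    have sumF: "F summable_on S"
      using summable_on_add[OF abs_summable_summable[OF absD] sumG] by simp
    have "T N - (\<Sum>\<^sub>\<infinity>s\<in>S. w s * G s) = (\<Sum>\<^sub>\<infinity>s\<in>S. F s - w s * G s)"
      unfolding TF using infsum_add[OF sumF summable_on_uminus[THEN iffD2, OF sumG]] infsum_uminus[of "\<lambda>s. w s * G s" S]
      by simp
    also have "norm \<dots> \<le> (\<Sum>\<^sub>\<infinity>s\<in>S. B s * h ^ Suc m)"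
      by (rule norm_infsum_le[OF has_sum_infsum[OF abs_summable_summable[OF absD]] has_sum_infsum[OF sumBh]])
        (use FB in auto)
    also have "\<dots> = (\<Sum>\<^sub>\<infinity>s\<in>S. B s) * \<bar>1 / real N ^ Suc m\<bar>"
      by (subst infsum_cmult_left') (simp add: h_def power_divide)
    finally show ?thesis
      unfolding G by simp
  qed
  show ?thesis
    using bound unfolding w_def g_def Y_def
    by (intro bigoI[where c = "\<Sum>\<^sub>\<infinity>s\<in>S. B s"])
      (auto simp: eventually_inf_principal intro!: eventually_mono[OF eventually_gt_at_top[of 0]])
qed

end

section \<open>Euler's product and the random variables\<close>

lemma has_sum_product_nonneg:
  fixes f :: "'a \<Rightarrow> real" and g :: "'b \<Rightarrow> real"
  assumes f: "(f has_sum a) A" and g: "(g has_sum b) B"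
    and nonneg: "\<And>x. x \<in> A \<Longrightarrow> 0 \<le> f x" "\<And>y. y \<in> B \<Longrightarrow> 0 \<le> g y"
  shows "((\<lambda>(x, y). f x * g y) has_sum a * b) (A \<times> B)"
proof (rule has_sum_SigmaI)
  show 1: "((\<lambda>y. case (x, y) of (x, y) \<Rightarrow> f x * g y) has_sum f x * b) B" for x
    using has_sum_cmult_right[OF g, of "f x"] by simp
  show 2: "((\<lambda>x. f x * b) has_sum a * b) A"
    by (rule has_sum_cmult_left[OF f])
  show "(\<lambda>(x, y). f x * g y) summable_on A \<times> B"
    by (rule summable_on_SigmaI[OF 1 has_sum_imp_summable[OF 2]]) (use nonneg in auto)
qed

definition partitions_le :: "nat \<Rightarrow> nat list set" where
  "partitions_le m = {\<alpha>. is_partition \<alpha> \<and> (\<forall>x\<in>set \<alpha>. x \<le> m)}"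

lemma partitions_le_0: "partitions_le 0 = {[]}"
proof -
  have "\<alpha> = []" if "is_partition \<alpha>" "\<forall>x\<in>set \<alpha>. x \<le> 0" for \<alpha>
    using that by (cases \<alpha>) (auto simp: is_partition_def)
  then show ?thesis by (auto simp: partitions_le_def is_partition_def)
qed

text \<open>The copies of the largest admissible part form a prefix; stripping them leaves parts at
  most \<open>m\<close>. Their number \<open>c\<close> is free and yields one geometric series, that
  is, one factor of Euler's product.\<close>

lemma partitions_le_Suc_bij:
  "bij_betw (\<lambda>(c, \<alpha>). replicate c (Suc m) @ \<alpha>) (UNIV \<times> partitions_le m) (partitions_le (Suc m))"
proof (rule bij_betwI[where g = "\<lambda>\<alpha>. (length (takeWhile ((=) (Suc m)) \<alpha>), dropWhile ((=) (Suc m)) \<alpha>)"])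
  show "(\<lambda>(c, \<alpha>). replicate c (Suc m) @ \<alpha>) \<in> UNIV \<times> partitions_le m \<rightarrow> partitions_le (Suc m)"
    by (auto simp: partitions_le_def is_partition_def sorted_wrt_append le_SucI)
      (auto simp: sorted_wrt_iff_nth_less)
  have less: "\<forall>x\<in>set (dropWhile ((=) (Suc m)) \<alpha>). x \<le> m" if "\<alpha> \<in> partitions_le (Suc m)" for \<alpha>
  proof (cases "dropWhile ((=) (Suc m)) \<alpha>")
    case Nil
    then show ?thesis unfolding Nil by simp
  next
    case (Cons y ys)
    have "y \<noteq> Suc m" using Cons by (metis dropWhile_eq_Cons_conv)
    moreover have "y \<in> set \<alpha>" using Cons by (metis list.set_intros(1) set_dropWhileD)
    ultimately have "y \<le> m" using that by (auto simp: partitions_le_def le_Suc_eq)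
    moreover have "sorted_wrt (\<ge>) (y # ys)"
      using that sorted_wrt_append[of "(\<ge>)" "takeWhile ((=) (Suc m)) \<alpha>" "y # ys"] Cons takeWhile_dropWhile_id[of "(=) (Suc m)" \<alpha>]
      by (simp add: partitions_le_def is_partition_def)
    ultimately show ?thesis using Cons by auto
  qed
  show "(\<lambda>\<alpha>. (length (takeWhile ((=) (Suc m)) \<alpha>), dropWhile ((=) (Suc m)) \<alpha>))
      \<in> partitions_le (Suc m) \<rightarrow> UNIV \<times> partitions_le m"
  proof
    fix \<alpha> assume \<alpha>: "\<alpha> \<in> partitions_le (Suc m)"
    then have "sorted_wrt (\<ge>) (takeWhile ((=) (Suc m)) \<alpha> @ dropWhile ((=) (Suc m)) \<alpha>)"
      by (simp add: partitions_le_def is_partition_def)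
    then have "is_partition (dropWhile ((=) (Suc m)) \<alpha>)"
      using \<alpha> by (auto simp: partitions_le_def is_partition_def sorted_wrt_append dest: set_dropWhileD)
    then show "(length (takeWhile ((=) (Suc m)) \<alpha>), dropWhile ((=) (Suc m)) \<alpha>) \<in> UNIV \<times> partitions_le m"
      using less[OF \<alpha>] by (simp add: partitions_le_def)
  qed
  show "(length (takeWhile ((=) (Suc m)) ((\<lambda>(c, \<alpha>). replicate c (Suc m) @ \<alpha>) p)),
      dropWhile ((=) (Suc m)) ((\<lambda>(c, \<alpha>). replicate c (Suc m) @ \<alpha>) p)) = p"
    if "p \<in> UNIV \<times> partitions_le m" for p
  proof -
    obtain c \<alpha> where p: "p = (c, \<alpha>)" by (cases p)
    then have \<alpha>: "\<forall>x\<in>set \<alpha>. x \<le> m"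
      using that by (simp add: partitions_le_def)
    have "takeWhile ((=) (Suc m)) (replicate c (Suc m) @ \<alpha>) = replicate c (Suc m)"
      "dropWhile ((=) (Suc m)) (replicate c (Suc m) @ \<alpha>) = \<alpha>"
      using \<alpha> by (cases \<alpha>; auto simp: takeWhile_append dropWhile_append)+
    then show ?thesis by (simp add: p)
  qed
  show "(\<lambda>(c, \<alpha>). replicate c (Suc m) @ \<alpha>)
      (length (takeWhile ((=) (Suc m)) \<alpha>), dropWhile ((=) (Suc m)) \<alpha>) = \<alpha>" for \<alpha>
  proof -
    have "\<forall>x\<in>set (takeWhile ((=) (Suc m)) \<alpha>). x = Suc m" by (auto dest: set_takeWhileD)
    then have "replicate (length (takeWhile ((=) (Suc m)) \<alpha>)) (Suc m) = takeWhile ((=) (Suc m)) \<alpha>"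
      by (rule replicate_length_same)
    then show ?thesis by (metis case_prod_conv takeWhile_dropWhile_id)
  qed
qed

lemma has_sum_partitions_le:
  fixes q :: real
  assumes q: "0 < q" "q < 1"
  shows "((\<lambda>\<alpha>. q ^ sum_list \<alpha>) has_sum inverse (\<Prod>k<m. 1 - q ^ Suc k)) (partitions_le m)"
proof (induction m)
  case 0
  then show ?case by (simp add: partitions_le_0 has_sum_finiteI)
next
  case (Suc m)
  have qm: "\<bar>q ^ Suc m\<bar> < 1" using q power_Suc_less_one[of q m] by simp
  have "((\<lambda>c. (q ^ Suc m) ^ c) has_sum inverse (1 - q ^ Suc m)) UNIV"
    using geometric_sums[of "q ^ Suc m"] qm q
    by (intro sums_nonneg_imp_has_sum) (auto simp: inverse_eq_divide)
  from has_sum_product_nonneg[OF this Suc.IH]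
  have "((\<lambda>(c, \<alpha>). (q ^ Suc m) ^ c * q ^ sum_list \<alpha>) has_sum
      inverse (1 - q ^ Suc m) * inverse (\<Prod>k<m. 1 - q ^ Suc k)) (UNIV \<times> partitions_le m)"
    using q by simp
  also have "inverse (1 - q ^ Suc m) * inverse (\<Prod>k<m. 1 - q ^ Suc k) = inverse (\<Prod>k<Suc m. 1 - q ^ Suc k)"
    by (simp add: inverse_mult_distrib mult.commute)
  also have "(\<lambda>(c, \<alpha>). (q ^ Suc m) ^ c * q ^ sum_list \<alpha>)
      = (\<lambda>p. q ^ sum_list ((\<lambda>(c, \<alpha>). replicate c (Suc m) @ \<alpha>) p))"
  proof -
    have "(q ^ Suc m) ^ c * q ^ s = q ^ (c * Suc m + s)" for c s
      by (simp only: power_add power_mult[symmetric] mult.commute[of c])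
    then show ?thesis by (auto simp: fun_eq_iff sum_list_replicate simp del: power_Suc)
  qed
  finally show ?case
    by (rule has_sum_reindex_bij_betw[OF partitions_le_Suc_bij, THEN iffD1])
qed

text \<open>All factors lie strictly between 0 and 1, so the partial products decrease to
  \<open>\<phi> q\<close>. Summability of \<open>q ^ Suc k\<close> gives convergence in the strict
  sense, which excludes the limit 0.\<close>

lemma euler_factors:
  fixes q :: real
  assumes q: "0 < q" "q < 1"
  shows "convergent_prod (\<lambda>k. 1 - q ^ Suc k)"
    and "(\<lambda>m. \<Prod>k<m. 1 - q ^ Suc k) \<longlonglongrightarrow> \<phi> q"
    and "0 < \<phi> q" "\<phi> q \<le> (\<Prod>k<m. 1 - q ^ Suc k)"
proof -
  have lt: "q ^ Suc k < 1" for k using q by (simp add: power_Suc_less_one del: power_Suc)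
  have "summable (\<lambda>k. \<bar>- (q ^ Suc k)\<bar>)"
    using q summable_geometric[of q] summable_Suc_iff[of "\<lambda>k. q ^ k"] by (simp del: power_Suc)
  moreover have "- (q ^ Suc k) \<noteq> -1" for k using lt[of k] by simp
  ultimately have "convergent_prod (\<lambda>k. 1 + - (q ^ Suc k))"
    by (rule summable_imp_convergent_prod_real)
  then show conv: "convergent_prod (\<lambda>k. 1 - q ^ Suc k)"
    by (simp only: add_uminus_conv_diff)
  from convergent_prod_LIMSEQ[OF conv]
  have "(\<lambda>m. \<Prod>k<Suc m. 1 - q ^ Suc k) \<longlonglongrightarrow> \<phi> q"
    by (simp only: lessThan_Suc_atMost \<phi>_def)
  then show lim: "(\<lambda>m. \<Prod>k<m. 1 - q ^ Suc k) \<longlonglongrightarrow> \<phi> q"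
    by (rule LIMSEQ_imp_Suc)
  have pos: "0 \<le> (\<Prod>k<m. 1 - q ^ Suc k)" for m
    using lt by (intro prod_nonneg) (auto simp: less_imp_le simp del: power_Suc)
  have "\<phi> q \<noteq> 0"
    unfolding \<phi>_def using lt by (intro prodinf_nonzero conv) (metis less_irrefl right_minus_eq)
  moreover have "\<phi> q \<ge> 0"
    using lim pos by (intro LIMSEQ_le_const) auto
  ultimately show "0 < \<phi> q" by simp
  have "decseq (\<lambda>m. \<Prod>k<m. 1 - q ^ Suc k)"
    using pos lt q by (intro decseq_SucI) (simp add: mult_right_le_one_le less_imp_le del: power_Suc)
  then show "\<phi> q \<le> (\<Prod>k<m. 1 - q ^ Suc k)"
    using lim by (rule decseq_ge)
qed

text \<open>Two-sided estimate by bounding the parts: each finite set of partitions lies in some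
  \<open>partitions_le m\<close>, whose sum is at most \<open>1 / \<phi> q\<close>; conversely the
  total dominates each of these sums and hence their limit.\<close>

theorem has_sum_partitions:
  fixes q :: real
  assumes q: "0 < q" "q < 1"
  shows "((\<lambda>\<alpha>. q ^ sum_list \<alpha>) has_sum 1 / \<phi> q) {\<alpha>. is_partition \<alpha>}"
proof -
  have nonneg: "0 \<le> q ^ n" for n using q by simp
  have bound: "sum (\<lambda>\<alpha>. q ^ sum_list \<alpha>) F \<le> 1 / \<phi> q" if F: "F \<subseteq> {\<alpha>. is_partition \<alpha>}" "finite F" for F
  proof -
    \<comment> \<open>A part never exceeds the size of its partition, so the largest size in
      \<open>F\<close> bounds all parts.\<close>
    define m where "m = Max (insert 0 (sum_list ` F))"
    have "F \<subseteq> partitions_le m"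
    proof
      fix \<alpha> assume "\<alpha> \<in> F"
      then have "sum_list \<alpha> \<le> m" using F(2) by (simp add: m_def)
      then show "\<alpha> \<in> partitions_le m"
        using F(1) \<open>\<alpha> \<in> F\<close> member_le_sum_list[of _ \<alpha>] by (force simp: partitions_le_def)
    qed
    then have "sum (\<lambda>\<alpha>. q ^ sum_list \<alpha>) F \<le> inverse (\<Prod>k<m. 1 - q ^ Suc k)"
      using has_sum_partitions_le[OF q, of m] F(2) nonneg by (intro finite_sum_le_has_sum) auto
    also have "\<dots> \<le> inverse (\<phi> q)"
      by (rule le_imp_inverse_le) (use euler_factors[OF q] in auto)
    finally show ?thesis by (simp add: inverse_eq_divide)
  qed
  have summ: "(\<lambda>\<alpha>. q ^ sum_list \<alpha>) summable_on {\<alpha>. is_partition \<alpha>}"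
    using bound nonneg by (intro nonneg_bdd_above_summable_on bdd_aboveI2) auto
  let ?T = "\<Sum>\<^sub>\<infinity>\<alpha> | is_partition \<alpha>. q ^ sum_list \<alpha>"
  have "?T \<le> 1 / \<phi> q"
    using summ bound by (intro infsum_le_finite_sums) auto
  moreover have "inverse (\<phi> q) \<le> ?T"
  proof (rule LIMSEQ_le_const2)
    show "(\<lambda>m. inverse (\<Prod>k<m. 1 - q ^ Suc k)) \<longlonglongrightarrow> inverse (\<phi> q)"
      using euler_factors[OF q] by (intro tendsto_inverse) auto
    show "\<exists>M. \<forall>m\<ge>M. inverse (\<Prod>k<m. 1 - q ^ Suc k) \<le> ?T"
      by (intro exI allI impI has_sum_mono2[OF has_sum_partitions_le[OF q] has_sum_infsum[OF summ]])
        (use nonneg in \<open>auto simp: partitions_le_def\<close>)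
  qed
  ultimately have "?T = 1 / \<phi> q" by (simp add: inverse_eq_divide)
  with summ show ?thesis by (simp add: has_sum_iff)
qed

section \<open>The two distributions as explicit mass functions\<close>

lemma pmf_embed_pmf_has_sum:
  assumes nonneg: "\<And>x. 0 \<le> f x" and sum: "(f has_sum 1) UNIV"
  shows "pmf (embed_pmf f) x = f x"
proof (rule pmf_embed_pmf[OF nonneg])
  have abs: "Infinite_Set_Sum.abs_summable_on f UNIV"
    using sum nonneg has_sum_imp_summable[OF sum] by (simp flip: abs_summable_equivalent)
  then have "infsetsum f UNIV = 1"
    using sum by (simp add: infsetsum_infsum infsumI)
  then show "(\<integral>\<^sup>+ x. ennreal (f x) \<partial>count_space UNIV) = 1"
    using nn_integral_conv_infsetsum[OF abs] nonneg by simp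
qed

lemma expectation_infsum:
  fixes f :: "'a \<Rightarrow> real"
  assumes "(\<lambda>x. pmf p x * f x) summable_on UNIV"
  shows "measure_pmf.expectation p f = (\<Sum>\<^sub>\<infinity>x. pmf p x * f x)"
proof -
  have "Infinite_Set_Sum.abs_summable_on (\<lambda>x. pmf p x * f x) UNIV"
    by (rule abs_summable_equivalent[THEN iffD1, OF summable_on_iff_abs_summable_on_real[THEN iffD1, OF assms]])
  then show ?thesis
    by (simp add: pmf_expectation_eq_infsetsum infsetsum_infsum)
qed

lemma pmf_q_uniform:
  assumes q: "0 < q" "q < 1"
  shows "pmf (q_uniform q) \<alpha> = (if is_partition \<alpha> then \<phi> q * q ^ sum_list \<alpha> else 0)"
  unfolding q_uniform_def
proof (rule pmf_embed_pmf_has_sum)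
  show "0 \<le> (if is_partition \<alpha> then \<phi> q * q ^ sum_list \<alpha> else 0)" for \<alpha>
    using q euler_factors(3)[OF q] by simp
  have "((\<lambda>\<alpha>. \<phi> q * q ^ sum_list \<alpha>) has_sum \<phi> q * (1 / \<phi> q)) {\<alpha>. is_partition \<alpha>}"
    by (rule has_sum_cmult_right[OF has_sum_partitions[OF q]])
  then have "((\<lambda>\<alpha>. \<phi> q * q ^ sum_list \<alpha>) has_sum 1) {\<alpha>. is_partition \<alpha>}"
    using euler_factors(3)[OF q] by simp
  then show "((\<lambda>\<alpha>. if is_partition \<alpha> then \<phi> q * q ^ sum_list \<alpha> else 0) has_sum 1) UNIV"
    by (rule has_sum_cong_neutral[THEN iffD1, rotated -1]) auto
qed

lemma summable_powi_square:
  assumes q: "0 < q" "q < (1::real)"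
  shows "(\<lambda>n::int. q powi n\<^sup>2) summable_on UNIV"
proof -
  have "(\<lambda>k::nat. q ^ k) summable_on UNIV"
    using q by (intro summable_nonneg_imp_summable_on) (auto intro: summable_geometric)
  then have nat: "(\<lambda>k::nat. q powi (int k)\<^sup>2) summable_on UNIV"
  proof (rule summable_on_comparison_test)
    \<comment> \<open>On the naturals \<open>k \<le> k\<^sup>2\<close> gives a geometric majorant;
      the negative integers are then treated as the mirror image of \<open>{1..}\<close>.\<close>
    show "q powi (int k)\<^sup>2 \<le> q ^ k" for k
    proof -
      have "q powi (int k)\<^sup>2 = q ^ (k\<^sup>2)" by (metis of_nat_power power_int_of_nat)
      also have "\<dots> \<le> q ^ k" using q by (intro power_decreasing) (auto simp: power2_eq_square)
      finally show ?thesis .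
    qed
  qed (use q in auto)
  have "(\<lambda>n::int. q powi n\<^sup>2) summable_on (range int)"
    using nat by (subst summable_on_reindex) (auto simp: o_def)
  moreover have "(\<lambda>n::int. q powi n\<^sup>2) summable_on ((\<lambda>k. - int k) ` {1..})"
    using summable_on_subset_banach[OF nat, of "{1..}"] by (subst summable_on_reindex) (auto simp: o_def inj_on_def)
  ultimately have "(\<lambda>n::int. q powi n\<^sup>2) summable_on (range int \<union> (\<lambda>k. - int k) ` {1..})"
    by (rule summable_on_Un_disjoint) auto
  also have "range int \<union> (\<lambda>k. - int k) ` {1..} = UNIV"
  proof -
    have "x \<in> range int \<union> (\<lambda>k. - int k) ` {1..}" for x
    proof (cases "x \<ge> 0")
      case True
      then show ?thesis by (metis UnI1 nat_0_le rangeI)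
    next
      case False
      then have "x = - int (nat (- x))" "nat (- x) \<in> {1..}" by auto
      then show ?thesis by (metis UnI2 imageI)
    qed
    then show ?thesis by blast
  qed
  finally show ?thesis .
qed

lemma theta_pos:
  assumes q: "0 < q" "q < 1"
  shows "0 < \<theta> q"
proof -
  have "(\<Sum>n\<in>{0::int}. q powi n\<^sup>2) \<le> \<theta> q"
    unfolding \<theta>_def by (rule finite_sum_le_infsum[OF summable_powi_square[OF q]]) (use q in auto)
  then show ?thesis by simp
qed

lemma pmf_integer_gaussian:
  assumes q: "0 < q" "q < 1"
  shows "pmf (integer_gaussian q) n = q powi n\<^sup>2 / \<theta> q"
  unfolding integer_gaussian_def
proof (rule pmf_embed_pmf_has_sum)
  show "0 \<le> q powi n\<^sup>2 / \<theta> q" for n using q theta_pos[OF q] by simp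
  have "((\<lambda>n. q powi n\<^sup>2 * inverse (\<theta> q)) has_sum \<theta> q * inverse (\<theta> q)) UNIV"
    unfolding \<theta>_def by (intro has_sum_cmult_left has_sum_infsum summable_powi_square[OF q])
  then show "((\<lambda>n. q powi n\<^sup>2 / \<theta> q) has_sum 1) UNIV"
    using theta_pos[OF q] by (simp add: divide_inverse)
qed

section \<open>Diagrams, conjugation and contents\<close>

lemma sum_1_shift: "(\<Sum>i = 1..n. f i) = (\<Sum>i<n. f (Suc i))" for n :: nat
  by (simp add: sum.atLeast1_atMost_eq)

lemma partition_nth_antimono:
  assumes "is_partition \<alpha>" "i \<le> j" "j < length \<alpha>"
  shows "\<alpha> ! j \<le> \<alpha> ! i"
  using assms by (cases "i = j") (auto simp: is_partition_def sorted_wrt_iff_nth_less)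

lemma partition_nth_pos: "is_partition \<alpha> \<Longrightarrow> i < length \<alpha> \<Longrightarrow> 0 < \<alpha> ! i"
  using nth_mem[of i \<alpha>] by (auto simp: is_partition_def Suc_le_eq)

text \<open>Rows and columns are counted from 0. Contents do not change, since both coordinates
  shift together.\<close>

definition diagram :: "nat list \<Rightarrow> (nat \<times> nat) set" where
  "diagram \<alpha> = (SIGMA i : {..<length \<alpha>}. {..<\<alpha> ! i})"

definition conjugate :: "nat list \<Rightarrow> nat list" where
  "conjugate \<alpha> = map (\<lambda>j. card {i. i < length \<alpha> \<and> j < \<alpha> ! i}) [0..<if \<alpha> = [] then 0 else \<alpha> ! 0]"

lemma card_diagram: "card (diagram \<alpha>) = sum_list \<alpha>"
  by (simp add: diagram_def sum_list_sum_nth atLeast0LessThan)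

lemma total_content_rows: "total_content \<alpha> = (\<Sum>i<length \<alpha>. \<Sum>j<\<alpha> ! i. int j - int i)"
  unfolding total_content_def sum_1_shift by simp

lemma total_content_diagram: "total_content \<alpha> = (\<Sum>(i, j)\<in>diagram \<alpha>. int j - int i)"
  by (simp add: total_content_rows diagram_def sum.Sigma)

text \<open>Since \<open>\<alpha>\<close> is nonincreasing, the rows longer than \<open>j\<close>
  form an initial segment of the indices, and an initial segment is determined by its
  cardinality.\<close>

lemma column_height_iff:
  assumes "is_partition \<alpha>"
  shows "i < card {i. i < length \<alpha> \<and> j < \<alpha> ! i} \<longleftrightarrow> i < length \<alpha> \<and> j < \<alpha> ! i"
proof -
  define X where "X = {i. i < length \<alpha> \<and> j < \<alpha> ! i}"
  have fin: "finite X" by (simp add: X_def)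
  have down: "k \<in> X" if "l \<in> X" "k \<le> l" for k l
    using that partition_nth_antimono[OF assms, of k l] by (auto simp: X_def)
  have "i < card X" if "i \<in> X"
  proof -
    have "{..i} \<subseteq> X" using down[OF that] by blast
    then show ?thesis using card_mono[OF fin, of "{..i}"] by simp
  qed
  moreover have "card X \<le> i" if "i \<notin> X"
  proof -
    have "X \<subseteq> {..<i}" using down that by (meson lessThan_iff not_le subsetI)
    then show ?thesis using card_mono[of "{..<i}" X] by simp
  qed
  ultimately have "i < card X \<longleftrightarrow> i \<in> X" by (meson not_le)
  then show ?thesis by (simp add: X_def)
qed

lemma diagram_conjugate:
  assumes "is_partition \<alpha>"
  shows "diagram (conjugate \<alpha>) = prod.swap ` diagram \<alpha>"
proof -
  have "j < length (conjugate \<alpha>) \<and> i < conjugate \<alpha> ! j \<longleftrightarrow> i < length \<alpha> \<and> j < \<alpha> ! i" for i j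
    using column_height_iff[OF assms, of i j] partition_nth_antimono[OF assms, of 0 i]
    by (auto simp: conjugate_def split: if_splits)
  then show ?thesis by (force simp: diagram_def)
qed

lemma is_partition_conjugate:
  assumes "is_partition \<alpha>"
  shows "is_partition (conjugate \<alpha>)"
proof -
  have pos: "1 \<le> conjugate \<alpha> ! j" if "j < length (conjugate \<alpha>)" for j
  proof -
    have "0 < length \<alpha> \<and> j < \<alpha> ! 0" using that by (auto simp: conjugate_def split: if_splits)
    then show ?thesis using that column_height_iff[OF assms, of 0 j] by (simp add: conjugate_def)
  qed
  have "conjugate \<alpha> ! k \<le> conjugate \<alpha> ! j" if "j < k" "k < length (conjugate \<alpha>)" for j k
    using that by (auto simp: conjugate_def intro!: card_mono)
  then show ?thesis
    using pos unfolding is_partition_def sorted_wrt_iff_nth_less by (metis in_set_conv_nth)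
qed

lemma diagram_inj:
  assumes "is_partition \<alpha>" "is_partition \<beta>" "diagram \<alpha> = diagram \<beta>"
  shows "\<alpha> = \<beta>"
proof (rule nth_equalityI)
  \<comment> \<open>All parts are positive, so column 0 meets every row and recovers the
    length.\<close>
  have len: "{..<length \<gamma>} = {i. (i, 0) \<in> diagram \<gamma>}" if "is_partition \<gamma>" for \<gamma>
    using partition_nth_pos[OF that] by (auto simp: diagram_def)
  from len[OF assms(1)] len[OF assms(2)] show eq: "length \<alpha> = length \<beta>"
    unfolding assms(3) by (metis card_lessThan)
  have row: "{..<\<gamma> ! i} = {j. (i, j) \<in> diagram \<gamma>}" if "i < length \<gamma>" for \<gamma> i
    using that by (auto simp: diagram_def)
  show "\<alpha> ! i = \<beta> ! i" if "i < length \<alpha>" for i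
    using row[OF that] row[of i \<beta>] that eq unfolding assms(3) by (metis card_lessThan)
qed

lemma conjugate_conjugate:
  assumes "is_partition \<alpha>"
  shows "conjugate (conjugate \<alpha>) = \<alpha>"
  using assms by (intro diagram_inj) (auto simp: is_partition_conjugate diagram_conjugate image_image)

lemma sum_list_conjugate: "is_partition \<alpha> \<Longrightarrow> sum_list (conjugate \<alpha>) = sum_list \<alpha>"
  by (simp add: card_diagram[symmetric] diagram_conjugate card_image)

lemma total_content_conjugate:
  assumes "is_partition \<alpha>"
  shows "total_content (conjugate \<alpha>) = - total_content \<alpha>"
  unfolding total_content_diagram diagram_conjugate[OF assms]
  by (subst sum.reindex) (auto simp: case_prod_unfold sum_negf[symmetric])

section \<open>Bounds on contents\<close>

lemma length_le_sum_list: "is_partition \<alpha> \<Longrightarrow> length \<alpha> \<le> sum_list \<alpha>"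
  unfolding is_partition_def by (induction \<alpha>) auto

lemma abs_content_le:
  assumes "is_partition \<alpha>"
  shows "\<bar>K \<alpha>\<bar> \<le> (weight \<alpha>)\<^sup>2"
proof -
  have "\<bar>int j - int i\<bar> \<le> int (sum_list \<alpha>)" if "(i, j) \<in> diagram \<alpha>" for i j
  proof -
    have "i < length \<alpha>" "j < \<alpha> ! i" using that by (auto simp: diagram_def)
    moreover have "\<alpha> ! i \<le> sum_list \<alpha>" using \<open>i < length \<alpha>\<close> by (intro member_le_sum_list) auto
    ultimately show ?thesis using length_le_sum_list[OF assms] by linarith
  qed
  then have "\<bar>total_content \<alpha>\<bar> \<le> (\<Sum>p\<in>diagram \<alpha>. int (sum_list \<alpha>))"
    unfolding total_content_diagram by (intro order_trans[OF sum_abs] sum_mono) auto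
  also have "\<dots> = (int (sum_list \<alpha>))\<^sup>2" by (simp add: card_diagram power2_eq_square)
  finally have "real_of_int \<bar>total_content \<alpha>\<bar> \<le> real_of_int ((int (sum_list \<alpha>))\<^sup>2)"
    by (simp only: of_int_le_iff)
  then show ?thesis by simp
qed

lemma content_rows: "2 * K \<alpha> = (\<Sum>i<length \<alpha>. real (\<alpha> ! i) * (real (\<alpha> ! i) - 1 - 2 * real i))"
proof -
  have row: "2 * (\<Sum>j<a. int j - int i) = int a * (int a - 1 - 2 * int i)" for a i :: nat
    by (induction a) (auto simp: algebra_simps)
  have "2 * total_content \<alpha> = (\<Sum>i<length \<alpha>. int (\<alpha> ! i) * (int (\<alpha> ! i) - 1 - 2 * int i))"
    by (simp only: total_content_rows sum_distrib_left[of 2 "\<lambda>i. \<Sum>j<\<alpha> ! i. int j - int i"] row)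
  then have "real_of_int (2 * total_content \<alpha>) = real_of_int (\<Sum>i<length \<alpha>. int (\<alpha> ! i) * (int (\<alpha> ! i) - 1 - 2 * int i))"
    by (rule arg_cong)
  then show ?thesis by simp
qed

lemma weight_rows: "weight \<alpha> = (\<Sum>i<length \<alpha>. real (\<alpha> ! i))"
  by (simp add: sum_list_sum_nth atLeast0LessThan)

text \<open>The factors \<open>2 i + 1 - length \<alpha>\<close> increase with \<open>i\<close> and
  sum to 0, while the parts decrease; by Chebyshev their product sum is at most 0. It is exactly
  what separates \<open>2 * K \<alpha>\<close> from the left-hand side.\<close>

lemma content_ge_squares:
  assumes "is_partition \<alpha>"
  shows "(\<Sum>i<length \<alpha>. (real (\<alpha> ! i))\<^sup>2) - real (length \<alpha>) * weight \<alpha> \<le> 2 * K \<alpha>"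
proof -
  let ?n = "length \<alpha>"
  have "real ?n * (\<Sum>i = 0..<?n. (2 * real i + 1 - real ?n) * real (\<alpha> ! i))
      \<le> (\<Sum>i = 0..<?n. 2 * real i + 1 - real ?n) * (\<Sum>i = 0..<?n. real (\<alpha> ! i))"
    using partition_nth_antimono[OF assms] by (intro Chebyshev_sum_upper) auto
  also have "(\<Sum>i = 0..<n. 2 * real i + 1 - c) = real n * (real n - c)" for n :: nat and c
    by (induction n) (auto simp: algebra_simps)
  then have "(\<Sum>i = 0..<?n. 2 * real i + 1 - real ?n) = 0" by simp
  finally have "(\<Sum>i<?n. (2 * real i + 1 - real ?n) * real (\<alpha> ! i)) \<le> 0"
    by (cases "?n = 0") (auto simp: mult_le_0_iff atLeast0LessThan)
  moreover have "2 * K \<alpha> = (\<Sum>i<?n. (real (\<alpha> ! i))\<^sup>2) - real ?n * weight \<alpha>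
      - (\<Sum>i<?n. (2 * real i + 1 - real ?n) * real (\<alpha> ! i))"
    unfolding content_rows weight_rows
    by (simp add: sum_distrib_left sum_subtractf[symmetric] power2_eq_square algebra_simps)
  ultimately show ?thesis by linarith
qed

text \<open>For types \<open>B\<close>, \<open>C\<close>, \<open>D\<close>: the surplus
  \<open>weight \<alpha>\<close>, from parts being at most their squares, compensates the shift of
  the content by \<open>- weight \<alpha> / 2\<close> in types \<open>B\<close> and
  \<open>D\<close>.\<close>

lemma content_ge_linear:
  assumes "is_partition \<alpha>"
  shows "weight \<alpha> - real (length \<alpha>) * weight \<alpha> \<le> 2 * K \<alpha>"
proof -
  have "real (\<alpha> ! i) \<le> (real (\<alpha> ! i))\<^sup>2" if "i < length \<alpha>" for i
    using partition_nth_pos[OF assms that] by (simp add: power2_eq_square)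
  then have "weight \<alpha> \<le> (\<Sum>i<length \<alpha>. (real (\<alpha> ! i))\<^sup>2)"
    unfolding weight_rows by (intro sum_mono) auto
  with content_ge_squares[OF assms] show ?thesis by linarith
qed

text \<open>For types \<open>A'\<close>, \<open>A\<close>: here the squares are kept and bounded
  below through Cauchy-Schwarz over at most \<open>N / 2\<close> rows, which leaves a reserve for
  the terms of second degree.\<close>

lemma content_ge_quadratic:
  assumes \<alpha>: "is_partition \<alpha>" and N: "2 * length \<alpha> \<le> N" "0 < N"
  shows "2 * (weight \<alpha>)\<^sup>2 / real N - real N / 2 * weight \<alpha> \<le> 2 * K \<alpha>"
proof -
  let ?Q = "\<Sum>i<length \<alpha>. (real (\<alpha> ! i))\<^sup>2"
  have Q: "0 \<le> ?Q" by (intro sum_nonneg) auto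
  have N': "real (length \<alpha>) \<le> real N / 2" using N(1) by linarith
  have "(weight \<alpha>)\<^sup>2 \<le> real (length \<alpha>) * ?Q"
    unfolding weight_rows using sum_squared_le_sum_of_squares[of "\<lambda>i. real (\<alpha> ! i)" "{..<length \<alpha>}"]
    by (simp add: mult.commute)
  also have "\<dots> \<le> real N / 2 * ?Q" using N' Q by (intro mult_right_mono)
  finally have "2 * (weight \<alpha>)\<^sup>2 / real N \<le> ?Q" using N(2) by (simp add: field_simps)
  moreover have "real (length \<alpha>) * weight \<alpha> \<le> real N / 2 * weight \<alpha>"
    using N' by (intro mult_right_mono) auto
  ultimately show ?thesis using content_ge_squares[OF \<alpha>] by linarith
qed

section \<open>Partitions of bounded length as nonnegative weights\<close>

definition pad :: "nat \<Rightarrow> nat list \<Rightarrow> int list" where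
  "pad r \<alpha> = map int \<alpha> @ replicate (r - length \<alpha>) 0"

definition short_partitions :: "nat \<Rightarrow> nat list set" where
  "short_partitions r = {\<alpha>. is_partition \<alpha> \<and> length \<alpha> \<le> r}"

definition weights :: "nat \<Rightarrow> int list set" where
  "weights r = {l. length l = r \<and> sorted_wrt (\<ge>) l \<and> (\<forall>x\<in>set l. 0 \<le> x)}"

text \<open>A partition has no zero parts, so the positive prefix of a nonincreasing nonnegative
  weight recovers it.\<close>

lemma bij_pad: "bij_betw (pad r) (short_partitions r) (weights r)"
proof (rule bij_betwI[where g = "\<lambda>l. takeWhile (\<lambda>x. 0 < x) (map nat l)"])
  show "pad r \<in> short_partitions r \<rightarrow> weights r"
    by (auto simp: pad_def short_partitions_def weights_def is_partition_def sorted_wrt_append sorted_wrt_map)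
      (auto simp: sorted_wrt_iff_nth_less)
  show "takeWhile (\<lambda>x. 0 < x) (map nat (pad r \<alpha>)) = \<alpha>" if "\<alpha> \<in> short_partitions r" for \<alpha>
  proof -
    have "map nat (pad r \<alpha>) = \<alpha> @ replicate (r - length \<alpha>) 0" by (simp add: pad_def o_def)
    moreover have "\<forall>x\<in>set \<alpha>. 0 < x" using that by (force simp: short_partitions_def is_partition_def)
    ultimately show ?thesis by (simp add: takeWhile_append2 takeWhile_replicate)
  qed
  show "(\<lambda>l. takeWhile (\<lambda>x. 0 < x) (map nat l)) \<in> weights r \<rightarrow> short_partitions r"
  proof
    fix l assume l: "l \<in> weights r"
    have "sorted_wrt (\<ge>) (map nat l)"
      using l by (auto simp: weights_def sorted_wrt_map elim: sorted_wrt_mono_rel[rotated])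
    then have "sorted_wrt (\<ge>) (takeWhile (\<lambda>x. 0 < x) (map nat l))"
      by (metis sorted_wrt_append takeWhile_dropWhile_id)
    moreover have "length (takeWhile (\<lambda>x. 0 < x) (map nat l)) \<le> r"
      using l length_takeWhile_le[of _ "map nat l"] by (simp add: weights_def)
    ultimately show "takeWhile (\<lambda>x. 0 < x) (map nat l) \<in> short_partitions r"
      by (auto simp: short_partitions_def is_partition_def dest: set_takeWhileD)
  qed
  show "pad r (takeWhile (\<lambda>x. 0 < x) (map nat l)) = l" if l: "l \<in> weights r" for l
  proof -
    define l1 l2 where "l1 = takeWhile (\<lambda>x. 0 < nat x) l" and "l2 = dropWhile (\<lambda>x. 0 < nat x) l"
    have l12: "l = l1 @ l2" by (simp add: l1_def l2_def)
    have "x = 0" if "x \<in> set l2" for x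
    proof (cases l2)
      case (Cons y ys)
      have "\<not> 0 < nat y" using Cons unfolding l2_def by (metis dropWhile_eq_Cons_conv)
      moreover have "sorted_wrt (\<ge>) l2" "\<forall>x\<in>set l2. 0 \<le> x"
        using l by (auto simp: weights_def l12 sorted_wrt_append)
      ultimately show ?thesis using Cons that by (auto intro: antisym)
    qed (use that in simp)
    then have "l2 = replicate (length l2) 0" by (metis replicate_length_same)
    moreover have "length l2 = r - length l1" using l by (auto simp: weights_def l12)
    ultimately have l2: "l2 = replicate (r - length l1) 0" by simp
    have "takeWhile (\<lambda>x. 0 < x) (map nat l) = map nat l1" by (simp add: takeWhile_map l1_def o_def)
    moreover have "map int (map nat l1) = l1"
      using l by (auto simp: weights_def l12 intro!: map_idI)
    ultimately show ?thesis
      unfolding pad_def by (simp add: l12 flip: l2)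
  qed
qed

section \<open>Heat traces as sums over partitions\<close>

lemma sum_entry_pad:
  fixes F :: "nat \<Rightarrow> real \<Rightarrow> real"
  assumes "length \<alpha> \<le> r" "\<And>i. F i 0 = 0"
  shows "(\<Sum>i = 1..r. F i (entry (pad r \<alpha>) i)) = (\<Sum>i<length \<alpha>. F (Suc i) (real (\<alpha> ! i)))"
proof -
  have "(\<Sum>i<r. F (Suc i) (entry (pad r \<alpha>) (Suc i))) = (\<Sum>i<length \<alpha>. F (Suc i) (real (\<alpha> ! i)))"
    using assms by (intro sum.mono_neutral_cong_right) (auto simp: entry_def pad_def nth_append)
  then show ?thesis unfolding sum_1_shift .
qed

lemma sum_weight_pad:
  assumes "length \<alpha> \<le> r"
  shows "(\<Sum>i = 1..r. entry (pad r \<alpha>) i) = weight \<alpha>"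
  using sum_entry_pad[OF assms, of "\<lambda>_ x. x"] by (simp add: weight_rows)

text \<open>In row \<open>i\<close> counted from 0 the bracket is
  \<open>(x - 1 - 2 * i) + (c - 1)\<close>: the first summand yields twice the content, the second a
  multiple of the size. The constant \<open>c\<close> is \<open>N\<close> in types \<open>B\<close>,
  \<open>D\<close>, \<open>N + 1\<close> in \<open>A'\<close>, \<open>A\<close> and
  \<open>N + 2\<close> in \<open>C\<close>.\<close>

lemma casimir_pad:
  assumes "length \<alpha> \<le> r"
  shows "(\<Sum>i = 1..r. entry (pad r \<alpha>) i * (entry (pad r \<alpha>) i + c - 2 * real i)) = 2 * K \<alpha> + (c - 1) * weight \<alpha>"
  using sum_entry_pad[OF assms, of "\<lambda>i x. x * (x + c - 2 * real i)"]
  unfolding content_rows weight_rows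
  by (simp add: sum_distrib_left sum.distrib[symmetric] algebra_simps)

section \<open>Weights of \<open>U(N)\<close> and \<open>SU(N)\<close> seen from a pivot
  entry\<close>

definition glue :: "int list \<Rightarrow> int list \<Rightarrow> int list" where
  "glue x y = x @ [0] @ map uminus (rev y)"

definition centred :: "nat \<Rightarrow> nat \<Rightarrow> int list set" where
  "centred a N = {l. length l = N \<and> sorted_wrt (\<ge>) l \<and> l ! a = 0}"

text \<open>With \<open>N = a + b + 1\<close> the index \<open>a + b + 2 - j\<close> is
  \<open>N + 1 - j\<close>: the defects are numbered from the bottom of the weight, so that the
  second list is again read in decreasing order.\<close>

lemma sum_glue:
  fixes F :: "nat \<Rightarrow> real \<Rightarrow> real"
  assumes "length x = a" "length y = b"
  shows "(\<Sum>i = 1..a + 1 + b. F i (entry (glue x y) i))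
    = (\<Sum>i = 1..a. F i (entry x i)) + F (a + 1) 0 + (\<Sum>j = 1..b. F (a + b + 2 - j) (- entry y j))"
proof -
  have split: "{1..a + 1 + b} = {1..a} \<union> ({a + 1} \<union> {a + 2..a + 1 + b})" by auto
  have "(\<Sum>i = 1..a. F i (entry (glue x y) i)) = (\<Sum>i = 1..a. F i (entry x i))"
    using assms by (intro sum.cong) (auto simp: entry_def glue_def nth_append)
  moreover have "entry (glue x y) (a + 1) = 0"
    using assms by (simp add: entry_def glue_def nth_append)
  moreover have "(\<Sum>i = a + 2..a + 1 + b. F i (entry (glue x y) i)) = (\<Sum>j = 1..b. F (a + b + 2 - j) (- entry y j))"
  proof (rule sum.reindex_bij_witness[of _ "\<lambda>j. a + b + 2 - j" "\<lambda>i. a + b + 2 - i"])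
    fix i assume i: "i \<in> {a + 2..a + 1 + b}"
    then have "glue x y ! (i - 1) = map uminus (rev y) ! (i - 1 - a - 1)"
      using assms by (auto simp: glue_def nth_append nth_Cons')
    also have "\<dots> = - (y ! (a + b + 2 - i - 1))"
      using i assms by (subst nth_map) (auto simp: rev_nth intro!: arg_cong[of _ _ "\<lambda>k. y ! k"])
    finally have "entry (glue x y) i = - entry y (a + b + 2 - i)" by (simp add: entry_def)
    then show "F (a + b + 2 - (a + b + 2 - i)) (- entry y (a + b + 2 - i)) = F i (entry (glue x y) i)"
      using i by simp
  qed auto
  ultimately show ?thesis
    unfolding split by (simp add: sum.union_disjoint)
qed

lemma glue_pad_sums:
  assumes \<alpha>: "length \<alpha> \<le> a" and \<beta>: "length \<beta> \<le> b" and N: "N = a + 1 + b"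
  defines "l \<equiv> glue (pad a \<alpha>) (pad b \<beta>)"
  shows "(\<Sum>i = 1..N. entry l i) = weight \<alpha> - weight \<beta>"
    and "(\<Sum>i = 1..N. entry l i * (entry l i + real N + 1 - 2 * real i))
      = 2 * (K \<alpha> + K \<beta>) + real N * (weight \<alpha> + weight \<beta>)"
proof -
  have len: "length (pad a \<alpha>) = a" "length (pad b \<beta>) = b" using \<alpha> \<beta> by (auto simp: pad_def)
  show "(\<Sum>i = 1..N. entry l i) = weight \<alpha> - weight \<beta>"
    using sum_glue[OF len, of "\<lambda>_ x. x"] sum_weight_pad[OF \<alpha>] sum_weight_pad[OF \<beta>]
    unfolding l_def N by (simp add: sum_negf)
  define F where "F = (\<lambda>i x. x * (x + real N + 1 - 2 * real i))"
  \<comment> \<open>Under \<open>i = N + 1 - j\<close> the term \<open>N + 1 - 2 i\<close> changes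
    sign, and so does the entry; the two signs cancel and \<open>\<beta>\<close> contributes by the
    same formula as \<open>\<alpha>\<close>.\<close>
  have "(\<Sum>j = 1..b. F (a + b + 2 - j) (- entry (pad b \<beta>) j))
      = (\<Sum>j = 1..b. entry (pad b \<beta>) j * (entry (pad b \<beta>) j + (real N + 1) - 2 * real j))"
    by (intro sum.cong refl) (auto simp: F_def N of_nat_diff algebra_simps)
  moreover have "(\<Sum>i = 1..a. F i (entry (pad a \<alpha>) i))
      = (\<Sum>i = 1..a. entry (pad a \<alpha>) i * (entry (pad a \<alpha>) i + (real N + 1) - 2 * real i))"
    by (simp add: F_def add.assoc)
  ultimately have "(\<Sum>i = 1..N. F i (entry l i)) = 2 * K \<alpha> + real N * weight \<alpha> + (2 * K \<beta> + real N * weight \<beta>)"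
    using sum_glue[OF len, of F] casimir_pad[OF \<alpha>, of "real N + 1"] casimir_pad[OF \<beta>, of "real N + 1"]
    unfolding l_def N[symmetric] by (simp add: F_def)
  then show "(\<Sum>i = 1..N. entry l i * (entry l i + real N + 1 - 2 * real i))
      = 2 * (K \<alpha> + K \<beta>) + real N * (weight \<alpha> + weight \<beta>)"
    by (simp add: F_def algebra_simps)
qed

lemma sum_rho: "(\<Sum>i = 1..N. real N + 1 - 2 * real i) = 0"
proof -
  have "(\<Sum>i = 1..n. c + 1 - 2 * real i) = real n * (c - real n)" for n :: nat and c
    by (induction n) (auto simp: algebra_simps)
  then show ?thesis by simp
qed

text \<open>The mixed term between \<open>n\<close> and \<open>N + 1 - 2 i\<close> cancels by
  \<open>sum_rho\<close>, so the shift sees the weight only through the sum of its entries.\<close>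

lemma shift_sums:
  assumes "length l = N"
  shows "(\<Sum>i = 1..N. entry (map (\<lambda>x. x + n) l) i) = (\<Sum>i = 1..N. entry l i) + real N * of_int n"
    and "(\<Sum>i = 1..N. entry (map (\<lambda>x. x + n) l) i * (entry (map (\<lambda>x. x + n) l) i + real N + 1 - 2 * real i))
      = (\<Sum>i = 1..N. entry l i * (entry l i + real N + 1 - 2 * real i))
        + 2 * of_int n * (\<Sum>i = 1..N. entry l i) + real N * (of_int n)\<^sup>2"
proof -
  have e: "entry (map (\<lambda>x. x + n) l) i = entry l i + of_int n" if "i \<in> {1..N}" for i
    using that assms by (auto simp: entry_def)
  show "(\<Sum>i = 1..N. entry (map (\<lambda>x. x + n) l) i) = (\<Sum>i = 1..N. entry l i) + real N * of_int n"
    by (simp add: e sum.distrib)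
  have "(\<Sum>i = 1..N. entry (map (\<lambda>x. x + n) l) i * (entry (map (\<lambda>x. x + n) l) i + real N + 1 - 2 * real i))
      = (\<Sum>i = 1..N. entry l i * (entry l i + real N + 1 - 2 * real i) + 2 * of_int n * entry l i
          + (of_int n)\<^sup>2 + of_int n * (real N + 1 - 2 * real i))"
    by (intro sum.cong refl) (simp add: e power2_eq_square algebra_simps)
  also have "\<dots> = (\<Sum>i = 1..N. entry l i * (entry l i + real N + 1 - 2 * real i))
        + 2 * of_int n * (\<Sum>i = 1..N. entry l i) + real N * (of_int n)\<^sup>2
        + of_int n * (\<Sum>i = 1..N. real N + 1 - 2 * real i)"
    by (simp only: sum.distrib sum_distrib_left[symmetric] sum_constant card_atLeastAtMost) simp
  finally show "(\<Sum>i = 1..N. entry (map (\<lambda>x. x + n) l) i * (entry (map (\<lambda>x. x + n) l) i + real N + 1 - 2 * real i))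
      = (\<Sum>i = 1..N. entry l i * (entry l i + real N + 1 - 2 * real i))
        + 2 * of_int n * (\<Sum>i = 1..N. entry l i) + real N * (of_int n)\<^sup>2"
    unfolding sum_rho by simp
qed

text \<open>A common shift is a twist by a power of the determinant, which is trivial on
  \<open>SU(N)\<close>; the subtracted square removes exactly the terms added by
  \<open>shift_sums\<close>. Centred weights may therefore replace those with last entry 0.\<close>

lemma c2_A_shift:
  assumes "length l = N" "N > 0"
  shows "c2 Type_A N (map (\<lambda>x. x + n) l) = c2 Type_A N l"
  unfolding c2.simps shift_sums[OF assms(1)] using assms(2)
  by (simp add: field_simps power2_eq_square)

lemma bij_glue:
  assumes N: "N = a + 1 + b"
  shows "bij_betw (\<lambda>(\<alpha>, \<beta>). glue (pad a \<alpha>) (pad b \<beta>)) (short_partitions a \<times> short_partitions b) (centred a N)"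
  unfolding bij_betw_def
proof
  have len: "length (pad r \<alpha>) = r" "sorted_wrt (\<ge>) (pad r \<alpha>)" "\<forall>x\<in>set (pad r \<alpha>). 0 \<le> x"
    if "\<alpha> \<in> short_partitions r" for r \<alpha>
    using bij_betwE[OF bij_pad] that by (auto simp: weights_def)
  have inj: "\<alpha> = \<alpha>'" if "pad r \<alpha> = pad r \<alpha>'" "\<alpha> \<in> short_partitions r" "\<alpha>' \<in> short_partitions r" for r \<alpha> \<alpha>'
    using bij_betw_imp_inj_on[OF bij_pad] that by (rule inj_onD)
  have surj: "\<exists>\<alpha>\<in>short_partitions r. x = pad r \<alpha>" if "x \<in> weights r" for r x
    using that bij_betw_imp_surj_on[OF bij_pad, of r] by blast
  show "inj_on (\<lambda>(\<alpha>, \<beta>). glue (pad a \<alpha>) (pad b \<beta>)) (short_partitions a \<times> short_partitions b)"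
  proof (rule inj_onI, clarify)
    fix \<alpha> \<beta> \<alpha>' \<beta>'
    assume *: "\<alpha> \<in> short_partitions a" "\<beta> \<in> short_partitions b" "\<alpha>' \<in> short_partitions a" "\<beta>' \<in> short_partitions b"
      and eq: "glue (pad a \<alpha>) (pad b \<beta>) = glue (pad a \<alpha>') (pad b \<beta>')"
    have "pad a \<alpha> = pad a \<alpha>'" "map uminus (rev (pad b \<beta>)) = map uminus (rev (pad b \<beta>'))"
      using eq len(1)[OF *(1)] len(1)[OF *(3)] by (auto simp: glue_def)
    then have "pad a \<alpha> = pad a \<alpha>'" "pad b \<beta> = pad b \<beta>'"
      by (auto simp: inj_map_eq_map)
    then show "\<alpha> = \<alpha>' \<and> \<beta> = \<beta>'" using * inj by blast
  qed
  show "(\<lambda>(\<alpha>, \<beta>). glue (pad a \<alpha>) (pad b \<beta>)) ` (short_partitions a \<times> short_partitions b) = centred a N"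
  proof (rule antisym; clarify)
    fix \<alpha> \<beta> assume *: "\<alpha> \<in> short_partitions a" "\<beta> \<in> short_partitions b"
    have "sorted_wrt (\<ge>) (map uminus (rev (pad b \<beta>)))"
      using len(2)[OF *(2)] by (simp add: sorted_wrt_map sorted_wrt_rev)
    then show "glue (pad a \<alpha>) (pad b \<beta>) \<in> centred a N"
      using len[OF *(1)] len[OF *(2)] N
      by (force simp: centred_def glue_def sorted_wrt_append nth_append)
  next
    fix l assume l: "l \<in> centred a N"
    define x y where "x = take a l" and "y = rev (map uminus (drop (Suc a) l))"
    have l_eq: "l = x @ [0] @ map uminus (rev y)"
      using l N id_take_nth_drop[of a l] by (simp add: centred_def x_def y_def rev_map o_def)
    have "sorted_wrt (\<ge>) (x @ [0] @ map uminus (rev y))"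
      using l l_eq by (simp add: centred_def)
    then have s: "sorted_wrt (\<ge>) x" "\<forall>u\<in>set x. 0 \<le> u" "sorted_wrt (\<ge>) (map uminus (rev y))" "\<forall>u\<in>set y. 0 \<le> u"
      by (auto simp: sorted_wrt_append)
    have "sorted_wrt (\<ge>) y"
      using s(3) by (simp add: sorted_wrt_map sorted_wrt_rev)
    then have "x \<in> weights a" "y \<in> weights b"
      using s l N by (auto simp: weights_def x_def y_def centred_def)
    then obtain \<alpha> \<beta> where "\<alpha> \<in> short_partitions a" "\<beta> \<in> short_partitions b" "x = pad a \<alpha>" "y = pad b \<beta>"
      using surj by meson
    then show "l \<in> (\<lambda>(\<alpha>, \<beta>). glue (pad a \<alpha>) (pad b \<beta>)) ` (short_partitions a \<times> short_partitions b)"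
      using l_eq by (auto simp: glue_def intro!: image_eqI[of _ _ "(\<alpha>, \<beta>)"])
  qed
qed

text \<open>The shift is recovered as the entry at the pivot, where a centred weight
  vanishes.\<close>

lemma bij_shift:
  assumes f: "bij_betw (\<lambda>(x, y). f x y) (X \<times> Y) (centred a N)" and a: "a < N"
  shows "bij_betw (\<lambda>(x, y, n). map (\<lambda>u. u + n) (f x y)) (X \<times> Y \<times> UNIV) (dual Type_A' N)"
  unfolding bij_betw_def
proof
  have c: "f x y \<in> centred a N" if "x \<in> X" "y \<in> Y" for x y
    using bij_betwE[OF f] that by auto
  show "inj_on (\<lambda>(x, y, n). map (\<lambda>u. u + n) (f x y)) (X \<times> Y \<times> UNIV)"
  proof (rule inj_onI)
    fix p p' assume p: "p \<in> X \<times> Y \<times> UNIV" "p' \<in> X \<times> Y \<times> UNIV"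
      and pp': "(case p of (x, y, n) \<Rightarrow> map (\<lambda>u. u + n) (f x y)) = (case p' of (x, y, n) \<Rightarrow> map (\<lambda>u. u + n) (f x y))"
    obtain x y n x' y' n' where eqs: "p = (x, y, n)" "p' = (x', y', n')"
      by (metis prod_cases3)
    from p pp' have *: "x \<in> X" "y \<in> Y" "x' \<in> X" "y' \<in> Y"
      and eq: "map (\<lambda>u. u + n) (f x y) = map (\<lambda>u. u + n') (f x' y')"
      by (auto simp: eqs)
    from arg_cong[OF eq, of "\<lambda>l. l ! a"] have n: "n = n'"
      using c[OF *(1,2)] c[OF *(3,4)] a by (simp add: centred_def)
    then have "f x y = f x' y'" using eq by (simp add: inj_map_eq_map inj_def)
    then have "(x, y) = (x', y')"
      using * by (intro inj_onD[OF bij_betw_imp_inj_on[OF f]]) auto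
    with n show "p = p'" by (simp add: eqs)
  qed
  show "(\<lambda>(x, y, n). map (\<lambda>u. u + n) (f x y)) ` (X \<times> Y \<times> UNIV) = dual Type_A' N"
  proof (intro antisym subsetI)
    fix l assume "l \<in> (\<lambda>(x, y, n). map (\<lambda>u. u + n) (f x y)) ` (X \<times> Y \<times> UNIV)"
    then obtain x y n where "x \<in> X" "y \<in> Y" "l = map (\<lambda>u. u + n) (f x y)" by auto
    then show "l \<in> dual Type_A' N"
      using c[of x y] by (simp add: centred_def dual_def sorted_wrt_map)
  next
    fix l assume l: "l \<in> dual Type_A' N"
    define l' where "l' = map (\<lambda>u. u - l ! a) l"
    have "l' \<in> centred a N" using l a by (simp add: l'_def centred_def dual_def sorted_wrt_map)
    then obtain x y where xy: "x \<in> X" "y \<in> Y" "l' = f x y"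
      using bij_betw_imp_surj_on[OF f] by force
    have "l = map (\<lambda>u. u + l ! a) l'" by (simp add: l'_def o_def)
    then show "l \<in> (\<lambda>(x, y, n). map (\<lambda>u. u + n) (f x y)) ` (X \<times> Y \<times> UNIV)"
      using xy by (intro image_eqI[of _ _ "(x, y, l ! a)"]) auto
  qed
qed

text \<open>Both sets contain one representative of each class of nonincreasing lists modulo common
  shifts, normalised at the pivot or at the last entry.\<close>

lemma bij_normalise:
  assumes a: "a < N"
  shows "bij_betw (\<lambda>l. map (\<lambda>u. u + (- last l)) l) (centred a N) (dual Type_A N)"
proof (rule bij_betwI[where g = "\<lambda>l. map (\<lambda>u. u + (- (l ! a))) l"])
  have last_le: "last l \<le> x" if "sorted_wrt (\<ge>) l" "x \<in> set l" for l :: "int list" and x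
  proof -
    have "l \<noteq> []" using that(2) by auto
    then have "sorted_wrt (\<ge>) (butlast l @ [last l])" "x \<in> set (butlast l @ [last l])"
      using that by simp_all
    then show ?thesis by (auto simp del: append_butlast_last_id simp: sorted_wrt_append)
  qed
  show "(\<lambda>l. map (\<lambda>u. u + (- last l)) l) \<in> centred a N \<rightarrow> dual Type_A N"
  proof
    fix l assume l: "l \<in> centred a N"
    then have "l \<noteq> []" using a by (auto simp: centred_def)
    then show "map (\<lambda>u. u + (- last l)) l \<in> dual Type_A N"
      using l last_le by (auto simp: centred_def dual_def sorted_wrt_map last_map)
  qed
  show "(\<lambda>l. map (\<lambda>u. u + (- (l ! a))) l) \<in> dual Type_A N \<rightarrow> centred a N"
    using a by (auto simp: centred_def dual_def sorted_wrt_map)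
  show "map (\<lambda>u. u + - (map (\<lambda>u. u + - last l) l ! a)) (map (\<lambda>u. u + - last l) l) = l"
    if "l \<in> centred a N" for l
    using that a by (auto simp: centred_def o_def)
  show "map (\<lambda>u. u + - last (map (\<lambda>u. u + - (l ! a)) l)) (map (\<lambda>u. u + - (l ! a)) l) = l"
    if "l \<in> dual Type_A N" for l
  proof -
    have "l \<noteq> []" using that a by (auto simp: dual_def)
    then show ?thesis using that by (auto simp: dual_def o_def last_map)
  qed
qed

lemma heat_trace_B:
  assumes "odd N" shows "heat_trace Type_B N t
    = (\<Sum>\<^sub>\<infinity>\<alpha>\<in>short_partitions (N div 2). exp (- t / 2 * weight \<alpha> + - t * (K \<alpha> - weight \<alpha> / 2) / real N))"
proof -
  define r where "r = weight_length Type_B N"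
  have r: "N div 2 = r" using assms by (auto simp: r_def elim!: oddE)
  have d: "dual Type_B N = weights r" by (simp add: dual_def weights_def r_def)
  have "exp (- t / 2 * c2 Type_B N (pad r \<alpha>)) = exp (- t / 2 * weight \<alpha> + - t * (K \<alpha> - weight \<alpha> / 2) / real N)"
    if "\<alpha> \<in> short_partitions r" for \<alpha>
  proof -
    have c: "c2 Type_B N (pad r \<alpha>) = (2 * K \<alpha> + (real N - 1) * weight \<alpha>) / real N"
      unfolding c2.simps r_def[symmetric] using casimir_pad[of \<alpha> r "real N"] that by (simp add: short_partitions_def)
    show ?thesis unfolding c using odd_pos[OF assms] by (simp add: field_simps)
  qed
  then show ?thesis
    unfolding heat_trace_def d infsum_reindex_bij_betw[OF bij_pad, symmetric] r by (intro infsum_cong) (auto simp del: c2.simps)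
qed

lemma heat_trace_C:
  assumes "even N" "N > 0" shows "heat_trace Type_C N t
    = (\<Sum>\<^sub>\<infinity>\<alpha>\<in>short_partitions (N div 2). exp (- t / 2 * weight \<alpha> + - t * (K \<alpha> + weight \<alpha> / 2) / real N))"
proof -
  define r where "r = weight_length Type_C N"
  have r: "N div 2 = r" by (auto simp: r_def)
  have d: "dual Type_C N = weights r" by (simp add: dual_def weights_def r_def)
  have "exp (- t / 2 * c2 Type_C N (pad r \<alpha>)) = exp (- t / 2 * weight \<alpha> + - t * (K \<alpha> + weight \<alpha> / 2) / real N)"
    if "\<alpha> \<in> short_partitions r" for \<alpha>
  proof -
    have c: "c2 Type_C N (pad r \<alpha>) = (2 * K \<alpha> + (real N + 1) * weight \<alpha>) / real N"
      unfolding c2.simps r_def[symmetric] using casimir_pad[of \<alpha> r "real N + 2"] that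
      by (simp add: short_partitions_def add.assoc)
    show ?thesis unfolding c using assms by (simp add: field_simps)
  qed
  then show ?thesis
    unfolding heat_trace_def d infsum_reindex_bij_betw[OF bij_pad, symmetric] r by (intro infsum_cong) (auto simp del: c2.simps)
qed

text \<open>The pivot is the middle index: \<open>a + 1 + b = N\<close> with both \<open>a\<close>
  and \<open>b\<close> at most \<open>N / 2\<close>, as the content bounds demand.\<close>

lemma heat_trace_A':
  assumes N: "N > 0"
  defines "a \<equiv> (N + 1) div 2 - 1" and "b \<equiv> N div 2"
  shows "heat_trace Type_A' N t
    = (\<Sum>\<^sub>\<infinity>(\<alpha>, \<beta>, n)\<in>short_partitions a \<times> short_partitions b \<times> UNIV.
        exp (- t / 2 * (weight \<alpha> + weight \<beta> + (of_int n)\<^sup>2)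
          + - t * (K \<alpha> + K \<beta> + of_int n * (weight \<alpha> - weight \<beta>)) / real N))"
proof -
  have N_eq: "N = a + 1 + b" using N by (auto simp: a_def b_def)
  have "exp (- t / 2 * c2 Type_A' N (map (\<lambda>u. u + n) (glue (pad a \<alpha>) (pad b \<beta>))))
      = exp (- t / 2 * (weight \<alpha> + weight \<beta> + (of_int n)\<^sup>2)
          + - t * (K \<alpha> + K \<beta> + of_int n * (weight \<alpha> - weight \<beta>)) / real N)"
    if "\<alpha> \<in> short_partitions a" "\<beta> \<in> short_partitions b" for \<alpha> \<beta> n
  proof -
    have len: "length \<alpha> \<le> a" "length \<beta> \<le> b" using that by (auto simp: short_partitions_def)
    then have "length (glue (pad a \<alpha>) (pad b \<beta>)) = N" by (simp add: glue_def pad_def N_eq)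
    note sums = shift_sums(2)[OF this, of n] glue_pad_sums[OF len N_eq]
    have c: "c2 Type_A' N (map (\<lambda>u. u + n) (glue (pad a \<alpha>) (pad b \<beta>)))
        = (2 * (K \<alpha> + K \<beta>) + real N * (weight \<alpha> + weight \<beta>)
          + 2 * of_int n * (weight \<alpha> - weight \<beta>) + real N * (of_int n)\<^sup>2) / real N"
      unfolding c2.simps sums ..
    show ?thesis unfolding c using N by (simp add: field_simps)
  qed
  note e = this
  have "a < N" by (simp add: N_eq)
  note bij = bij_shift[OF bij_glue[OF N_eq] this]
  show ?thesis
    unfolding heat_trace_def infsum_reindex_bij_betw[OF bij, symmetric]
  proof (rule infsum_cong)
    fix p assume "p \<in> short_partitions a \<times> short_partitions b \<times> (UNIV :: int set)"
    then obtain \<alpha> \<beta> n where p: "p = (\<alpha>, \<beta>, n)" "\<alpha> \<in> short_partitions a" "\<beta> \<in> short_partitions b"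
      by auto
    show "exp (- t / 2 * c2 Type_A' N (case p of (\<alpha>, \<beta>, n) \<Rightarrow> map (\<lambda>u. u + n) (glue (pad a \<alpha>) (pad b \<beta>))))
      = (case p of (\<alpha>, \<beta>, n) \<Rightarrow> exp (- t / 2 * (weight \<alpha> + weight \<beta> + (of_int n)\<^sup>2)
          + - t * (K \<alpha> + K \<beta> + of_int n * (weight \<alpha> - weight \<beta>)) / real N))"
      unfolding p(1) prod.case by (rule e[OF p(2,3)])
  qed
qed

text \<open>The eigenvalue is computed on the centred weight and carried along
  \<open>bij_normalise\<close> by \<open>c2_A_shift\<close>, so that no integer \<open>n\<close>
  remains and the square of the sum of entries supplies the correction of order
  \<open>1 / N\<^sup>2\<close>.\<close>

lemma heat_trace_A:
  assumes N: "N > 0"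
  defines "a \<equiv> (N + 1) div 2 - 1" and "b \<equiv> N div 2"
  shows "heat_trace Type_A N t
    = (\<Sum>\<^sub>\<infinity>(\<alpha>, \<beta>)\<in>short_partitions a \<times> short_partitions b.
        exp (- t / 2 * (weight \<alpha> + weight \<beta>) + - t * (K \<alpha> + K \<beta>) / real N
          + t / 2 * (weight \<alpha> - weight \<beta>)\<^sup>2 / (real N)\<^sup>2))"
proof -
  have N_eq: "N = a + 1 + b" using N by (auto simp: a_def b_def)
  have "exp (- t / 2 * c2 Type_A N (map (\<lambda>u. u + - last (glue (pad a \<alpha>) (pad b \<beta>))) (glue (pad a \<alpha>) (pad b \<beta>))))
      = exp (- t / 2 * (weight \<alpha> + weight \<beta>) + - t * (K \<alpha> + K \<beta>) / real N
          + t / 2 * (weight \<alpha> - weight \<beta>)\<^sup>2 / (real N)\<^sup>2)"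
    if "\<alpha> \<in> short_partitions a" "\<beta> \<in> short_partitions b" for \<alpha> \<beta>
  proof -
    have len: "length \<alpha> \<le> a" "length \<beta> \<le> b" using that by (auto simp: short_partitions_def)
    then have l: "length (glue (pad a \<alpha>) (pad b \<beta>)) = N" by (simp add: glue_def pad_def N_eq)
    have "c2 Type_A N (glue (pad a \<alpha>) (pad b \<beta>))
        = (2 * (K \<alpha> + K \<beta>) + real N * (weight \<alpha> + weight \<beta>)) / real N - (weight \<alpha> - weight \<beta>)\<^sup>2 / (real N)\<^sup>2"
      unfolding c2.simps glue_pad_sums[OF len N_eq] ..
    also have "\<dots> = weight \<alpha> + weight \<beta> + 2 * (K \<alpha> + K \<beta>) / real N - (weight \<alpha> - weight \<beta>)\<^sup>2 / (real N)\<^sup>2"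
      using N by (simp add: add_divide_distrib)
    finally have c: "c2 Type_A N (glue (pad a \<alpha>) (pad b \<beta>))
        = weight \<alpha> + weight \<beta> + 2 * (K \<alpha> + K \<beta>) / real N - (weight \<alpha> - weight \<beta>)\<^sup>2 / (real N)\<^sup>2" .
    show ?thesis
      unfolding c2_A_shift[OF l N] c by (simp add: algebra_simps add_divide_distrib diff_divide_distrib)
  qed
  note e = this
  have "a < N" by (simp add: N_eq)
  note bij = bij_betw_trans[OF bij_glue[OF N_eq] bij_normalise[OF this]]
  show ?thesis
    unfolding heat_trace_def infsum_reindex_bij_betw[OF bij, symmetric]
  proof (rule infsum_cong)
    fix p assume "p \<in> short_partitions a \<times> short_partitions b"
    then obtain \<alpha> \<beta> where p: "p = (\<alpha>, \<beta>)" "\<alpha> \<in> short_partitions a" "\<beta> \<in> short_partitions b"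
      by auto
    show "exp (- t / 2 * c2 Type_A N (((\<lambda>l. map (\<lambda>u. u + - last l) l) \<circ> (\<lambda>(\<alpha>, \<beta>). glue (pad a \<alpha>) (pad b \<beta>))) p))
      = (case p of (\<alpha>, \<beta>) \<Rightarrow> exp (- t / 2 * (weight \<alpha> + weight \<beta>) + - t * (K \<alpha> + K \<beta>) / real N
          + t / 2 * (weight \<alpha> - weight \<beta>)\<^sup>2 / (real N)\<^sup>2))"
      unfolding p(1) prod.case o_apply by (rule e[OF p(2,3)])
  qed
qed

section \<open>Weights of \<open>SO(N)\<close>, \<open>N\<close> even, and the sign of the last
  entry\<close>

lemma bij_negate_last:
  assumes r: "r = N div 2" "0 < r"
  shows "bij_betw (\<lambda>l. butlast l @ [- last l]) {l \<in> weights r. 0 < last l} {l \<in> dual Type_D N. last l < 0}"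
proof (rule bij_betwI[where g = "\<lambda>l. butlast l @ [- last l]"])
  have snoc: "\<exists>k y. l = k @ [y]" if "length l = r" for l :: "int list"
    using that r(2) by (cases l rule: rev_cases) auto
  show "(\<lambda>l. butlast l @ [- last l]) \<in> {l \<in> weights r. 0 < last l} \<rightarrow> {l \<in> dual Type_D N. last l < 0}"
  proof
    fix l assume l: "l \<in> {l \<in> weights r. 0 < last l}"
    then obtain k y where "l = k @ [y]" using snoc by (force simp: weights_def)
    then show "butlast l @ [- last l] \<in> {l \<in> dual Type_D N. last l < 0}"
      using l r by (simp add: weights_def dual_def)
  qed
  show "(\<lambda>l. butlast l @ [- last l]) \<in> {l \<in> dual Type_D N. last l < 0} \<rightarrow> {l \<in> weights r. 0 < last l}"
  proof
    fix l assume l: "l \<in> {l \<in> dual Type_D N. last l < 0}"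
    then obtain k y where k: "l = k @ [y]" using snoc r by (force simp: dual_def)
    with l have "sorted_wrt (\<ge>) k" "\<forall>x\<in>set k. \<bar>y\<bar> \<le> x" "y < 0" "length l = r"
      using r by (auto simp: dual_def sorted_wrt_append)
    then show "butlast l @ [- last l] \<in> {l \<in> weights r. 0 < last l}"
      by (force simp: weights_def sorted_wrt_append k)
  qed
  show "butlast (butlast l @ [- last l]) @ [- last (butlast l @ [- last l])] = l"
    if "l \<in> {l \<in> weights r. 0 < last l}" for l
    using that snoc[of l] by (auto simp: weights_def)
  show "butlast (butlast l @ [- last l]) @ [- last (butlast l @ [- last l])] = l"
    if "l \<in> {l \<in> dual Type_D N. last l < 0}" for l
    using that snoc[of l] r by (auto simp: dual_def)
qed

lemma dual_D_nonneg:
  assumes "r = N div 2" "0 < r"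
  shows "{l \<in> dual Type_D N. 0 \<le> last l} = weights r"
proof -
  have ne: "l \<noteq> []" if "length l = r" for l :: "int list" using that \<open>0 < r\<close> by auto
  have "sorted_wrt (\<ge>) l \<Longrightarrow> l \<noteq> [] \<Longrightarrow> 0 \<le> last l \<Longrightarrow> x \<in> set l \<Longrightarrow> 0 \<le> x" for l :: "int list" and x
    by (induction l rule: rev_induct) (auto simp: sorted_wrt_append)
  then show ?thesis
    using ne by (auto simp: dual_def weights_def assms(1))
qed

text \<open>In the last row \<open>N - 2 * i\<close> is 0, so the last entry enters only through its
  square.\<close>

lemma c2_D_negate_last:
  assumes "even N" "length l = N div 2" "0 < N"
  shows "c2 Type_D N (butlast l @ [- last l]) = c2 Type_D N l"
proof -
  obtain r where r: "N = 2 * r" using assms by (auto elim: evenE)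
  have ne: "l \<noteq> []" using assms r by auto
  have e: "entry (butlast l @ [- last l]) i = entry l i" if "i \<in> {1..<r}" for i
    using that assms(2) r by (auto simp: entry_def nth_append nth_butlast)
  have er: "entry (butlast l @ [- last l]) r = - entry l r"
    using assms(2) r ne by (auto simp: entry_def nth_append last_conv_nth)
  have "0 < r" using assms r by simp
  then have split: "{1..r} = insert r {1..<r}" by auto
  have "(\<Sum>i = 1..r. entry (butlast l @ [- last l]) i * (entry (butlast l @ [- last l]) i + real N - 2 * real i))
      = (\<Sum>i = 1..r. entry l i * (entry l i + real N - 2 * real i))"
    unfolding split by (simp add: er e r)
  then show ?thesis by (simp add: r)
qed

lemma last_pad_pos:
  assumes "0 < r" "\<alpha> \<in> short_partitions r"
  shows "0 < last (pad r \<alpha>) \<longleftrightarrow> \<alpha> \<notin> short_partitions (r - 1)"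
proof (cases "length \<alpha> = r")
  case True
  then have "\<alpha> \<noteq> []" using assms by auto
  then have "0 < last \<alpha>"
    using assms(2) by (auto simp: short_partitions_def is_partition_def Suc_le_eq)
  then show ?thesis using True assms \<open>\<alpha> \<noteq> []\<close> by (auto simp: pad_def last_map short_partitions_def)
next
  case False
  then show ?thesis using assms by (auto simp: pad_def short_partitions_def)
qed

text \<open>The weights with negative last entry are in bijection with the partitions of length exactly
  \<open>N / 2\<close>; writing their contribution as a difference of two sums lets both be expanded alike.\<close>

lemma heat_trace_D:
  assumes N: "even N" "N > 0"
    and f: "f = (\<lambda>\<alpha>. exp (- t / 2 * weight \<alpha> + - t * (K \<alpha> - weight \<alpha> / 2) / real N))"
    and summ: "f summable_on short_partitions (N div 2)"
  shows "heat_trace Type_D N t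
    = 2 * infsum f (short_partitions (N div 2)) - infsum f (short_partitions (N div 2 - 1))"
proof -
  define r where "r = N div 2"
  define E where "E = (\<lambda>l. exp (- t / 2 * c2 Type_D N l))"
  have r: "r = N div 2" "0 < r" using N by (auto simp: r_def)
  have Ef: "E (pad r \<alpha>) = f \<alpha>" if "\<alpha> \<in> short_partitions r" for \<alpha>
  proof -
    have c: "c2 Type_D N (pad r \<alpha>) = (2 * K \<alpha> + (real N - 1) * weight \<alpha>) / real N"
      unfolding c2.simps weight_length.simps r_def[symmetric]
      using casimir_pad[of \<alpha> r "real N"] that by (simp add: short_partitions_def)
    show ?thesis unfolding E_def f c using N by (simp add: field_simps)
  qed
  have f_summ: "f summable_on short_partitions r" using summ by (simp add: r)
  have sub: "short_partitions (r - 1) \<subseteq> short_partitions r" by (auto simp: short_partitions_def)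
  have E_sum: "(E has_sum infsum f (short_partitions r)) (weights r)"
  proof (rule has_sum_reindex_bij_betw[OF bij_pad, THEN iffD1])
    show "((\<lambda>\<alpha>. E (pad r \<alpha>)) has_sum infsum f (short_partitions r)) (short_partitions r)"
      by (rule has_sum_cong[THEN iffD2, rotated, OF has_sum_infsum[OF f_summ]]) (rule Ef)
  qed
  have pad_pos: "bij_betw (pad r) (short_partitions r - short_partitions (r - 1)) {l \<in> weights r. 0 < last l}"
  proof (rule bij_betw_subset[OF bij_pad])
    show "pad r ` (short_partitions r - short_partitions (r - 1)) = {l \<in> weights r. 0 < last l}"
    proof -
      have "{l \<in> weights r. 0 < last l} = pad r ` {\<alpha> \<in> short_partitions r. 0 < last (pad r \<alpha>)}"
        unfolding bij_betw_imp_surj_on[OF bij_pad, of r, symmetric] by blast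
      also have "{\<alpha> \<in> short_partitions r. 0 < last (pad r \<alpha>)} = short_partitions r - short_partitions (r - 1)"
        using last_pad_pos[OF r(2)] by blast
      finally show ?thesis ..
    qed
  qed auto
  \<comment> \<open>Subtraction requires genuine convergence of both sums, since
    \<open>infsum\<close> takes the default value 0 on divergent families.\<close>
  have diff: "(f has_sum infsum f (short_partitions r) - infsum f (short_partitions (r - 1))) (short_partitions r - short_partitions (r - 1))"
    by (intro has_sum_Diff has_sum_infsum f_summ sub summable_on_subset_banach[OF f_summ sub])
  have "(E has_sum infsum f (short_partitions r) - infsum f (short_partitions (r - 1))) {l \<in> weights r. 0 < last l}"
  proof (rule has_sum_reindex_bij_betw[OF pad_pos, THEN iffD1])
    show "((\<lambda>\<alpha>. E (pad r \<alpha>)) has_sum infsum f (short_partitions r) - infsum f (short_partitions (r - 1)))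
        (short_partitions r - short_partitions (r - 1))"
      by (rule has_sum_cong[THEN iffD2, rotated, OF diff]) (use Ef in blast)
  qed
  also have "?this \<longleftrightarrow> ((\<lambda>l. E (butlast l @ [- last l])) has_sum infsum f (short_partitions r) - infsum f (short_partitions (r - 1))) {l \<in> weights r. 0 < last l}"
    using c2_D_negate_last[OF N(1) _ N(2)] by (intro has_sum_cong) (auto simp: E_def weights_def r)
  finally have E_neg: "(E has_sum infsum f (short_partitions r) - infsum f (short_partitions (r - 1))) {l \<in> dual Type_D N. last l < 0}"
    using has_sum_reindex_bij_betw[OF bij_negate_last[OF r], of E] by simp
  have "(E has_sum infsum f (short_partitions r) + (infsum f (short_partitions r) - infsum f (short_partitions (r - 1))))
      (weights r \<union> {l \<in> dual Type_D N. last l < 0})"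
  proof (intro has_sum_Un_disjoint E_sum E_neg)
    show "weights r \<inter> {l \<in> dual Type_D N. last l < 0} = {}"
      unfolding dual_D_nonneg[OF r, symmetric] by auto
  qed
  moreover have "weights r \<union> {l \<in> dual Type_D N. last l < 0} = dual Type_D N"
    unfolding dual_D_nonneg[OF r, symmetric] by auto
  ultimately show ?thesis
    unfolding heat_trace_def E_def[symmetric] r(1)[symmetric] by (simp add: infsumI)
qed

section \<open>Asymptotic expansions\<close>

text \<open>For exponents without a term of order \<open>1 / N\<^sup>2\<close>, where
  \<open>c i j\<close> contains the factor \<open>0 ^ j\<close>.\<close>

lemma sum_two_scale_no_b:
  fixes c :: "nat \<Rightarrow> nat \<Rightarrow> real"
  assumes "\<And>i j. 0 < j \<Longrightarrow> c i j = 0"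
  shows "(\<Sum>(i, j) | i + 2 * j \<le> m. c i j / x ^ (i + 2 * j)) = (\<Sum>k = 0..m. c k 0 / x ^ k)"
proof -
  have "(\<Sum>(i, j) | i + 2 * j \<le> m. c i j / x ^ (i + 2 * j))
      = (\<Sum>(i, j)\<in>(\<lambda>k. (k, 0)) ` {0..m}. c i j / x ^ (i + 2 * j))"
    using finite_triangle(1)[of m] assms by (intro sum.mono_neutral_right) (auto simp: image_iff)
  also have "\<dots> = (\<Sum>k = 0..m. c k 0 / x ^ k)"
    by (subst sum.reindex) (auto simp: inj_on_def)
  finally show ?thesis .
qed

text \<open>Truncation at the odd order \<open>2 * p + 1\<close> yields the remainder order
  \<open>2 * p + 2\<close>, and the additional top order brings no coefficient because it involves
  odd \<open>i\<close> only.\<close>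

lemma sum_two_scale_even:
  fixes c :: "nat \<Rightarrow> nat \<Rightarrow> real"
  assumes "\<And>i j. odd i \<Longrightarrow> c i j = 0"
  shows "(\<Sum>(i, j) | i + 2 * j \<le> 2 * p + 1. c i j / x ^ (i + 2 * j))
    = (\<Sum>k = 0..p. (\<Sum>i\<le>k. c (2 * i) (k - i)) / x ^ (2 * k))"
proof -
  have "(\<Sum>(i, j) | i + 2 * j \<le> 2 * p + 1. c i j / x ^ (i + 2 * j))
      = (\<Sum>(i, j)\<in>(\<lambda>(i, j). (2 * i, j)) ` {(i, j). i + j \<le> p}. c i j / x ^ (i + 2 * j))"
  proof (intro sum.mono_neutral_right)
    show "finite {(i, j). i + 2 * j \<le> 2 * p + 1}" by (rule finite_triangle)
    show "\<forall>q\<in>{(i, j). i + 2 * j \<le> 2 * p + 1} - (\<lambda>(i, j). (2 * i, j)) ` {(i, j). i + j \<le> p}.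
        (case q of (i, j) \<Rightarrow> c i j / x ^ (i + 2 * j)) = 0"
    proof clarify
      fix i j assume ij: "i + 2 * j \<le> 2 * p + 1" "(i, j) \<notin> (\<lambda>(i, j). (2 * i, j)) ` {(i, j). i + j \<le> p}"
      have "odd i"
      proof
        assume "even i"
        then obtain i' where "i = 2 * i'" by (rule evenE)
        with ij show False by (auto simp: image_iff)
      qed
      then show "c i j / x ^ (i + 2 * j) = 0" by (simp add: assms)
    qed
  qed auto
  also have "\<dots> = (\<Sum>(i, j) | i + j \<le> p. c (2 * i) j / x ^ (2 * i + 2 * j))"
    by (subst sum.reindex) (auto simp: inj_on_def case_prod_unfold)
  also have "\<dots> = (\<Sum>k\<le>p. \<Sum>i\<le>k. c (2 * i) (k - i) / x ^ (2 * i + 2 * (k - i)))"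
    by (rule sum.triangle_reindex_eq)
  also have "\<dots> = (\<Sum>k = 0..p. (\<Sum>i\<le>k. c (2 * i) (k - i)) / x ^ (2 * k))"
    unfolding atLeast0AtMost by (intro sum.cong refl) (simp add: sum_divide_distrib flip: distrib_left)
  finally show ?thesis .
qed

lemma sum_triples:
  fixes g :: "nat \<Rightarrow> nat \<Rightarrow> nat \<Rightarrow> real"
  shows "(\<Sum>i\<le>k. \<Sum>j\<le>i. g j (i - j) (k - i)) = (\<Sum>(k1, k2, k3)\<in>{(k1, k2, k3). k1 + k2 + k3 = k}. g k1 k2 k3)"
proof -
  have "(\<Sum>i\<le>k. \<Sum>j\<le>i. g j (i - j) (k - i)) = (\<Sum>(i, j)\<in>(SIGMA i : {..k}. {..i}). g j (i - j) (k - i))"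
    by (simp add: sum.Sigma)
  also have "\<dots> = (\<Sum>(k1, k2, k3)\<in>{(k1, k2, k3). k1 + k2 + k3 = k}. g k1 k2 k3)"
    \<comment> \<open>Here \<open>i = k1 + k2\<close> is the power of the sum of contents,
      \<open>j = k1\<close> the share of the first partition in its binomial expansion, and
      \<open>k - i = k3\<close>.\<close>
    by (rule sum.reindex_bij_witness[of _ "\<lambda>(k1, k2, k3). (k1 + k2, k1)" "\<lambda>(i, j). (j, i - j, k - i)"]) auto
  finally show ?thesis .
qed

lemma sum_even_indices:
  fixes g :: "nat \<Rightarrow> real"
  assumes "\<And>u. odd u \<Longrightarrow> g u = 0"
  shows "(\<Sum>u\<le>2 * i. g u) = (\<Sum>j\<le>i. g (2 * j))"
  by (induction i) (use assms in auto)

lemma q_of: "0 < t \<Longrightarrow> 0 < q_of t \<and> q_of t < 1"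
  by (simp add: q_of_def)

lemma q_of_power: "q_of t ^ n = exp (- t / 2 * real n)"
  unfolding q_of_def by (simp add: exp_of_nat_mult[symmetric] mult.commute)

lemma q_of_powi: "q_of t powi n = exp (- t / 2 * real_of_int n)"
  unfolding q_of_def by (simp add: exp_power_int mult.commute)

section \<open>The three index sets: one partition, two partitions, two partitions with an
  integer\<close>

abbreviation partitions :: "nat list set" where
  "partitions \<equiv> {\<alpha>. is_partition \<alpha>}"

text \<open>The rate \<open>\<epsilon>\<close> corresponds to the parameter
  \<open>q_of (2 * \<epsilon>)\<close>, so Euler's product covers every positive rate.\<close>

lemma summable_exp_weight:
  fixes \<epsilon> :: real
  assumes "0 < \<epsilon>"
  shows "(\<lambda>\<alpha>. exp (- \<epsilon> * weight \<alpha>)) summable_on partitions"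
  using has_sum_imp_summable[OF has_sum_partitions[of "q_of (2 * \<epsilon>)"]] assms q_of[of "2 * \<epsilon>"]
  by (simp add: q_of_power)

lemma summable_exp_square:
  fixes \<epsilon> :: real
  assumes "0 < \<epsilon>"
  shows "(\<lambda>n::int. exp (- \<epsilon> * (of_int n)\<^sup>2)) summable_on UNIV"
  using summable_powi_square[of "q_of (2 * \<epsilon>)"] assms q_of[of "2 * \<epsilon>"]
  by (simp add: q_of_powi)

lemma summable_on_product_nonneg:
  fixes f :: "'a \<Rightarrow> real" and g :: "'b \<Rightarrow> real"
  assumes "f summable_on A" "g summable_on B" "\<And>x. 0 \<le> f x" "\<And>y. 0 \<le> g y"
  shows "(\<lambda>(x, y). f x * g y) summable_on A \<times> B"
  using has_sum_product_nonneg[OF has_sum_infsum[OF assms(1)] has_sum_infsum[OF assms(2)]] assms(3,4)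
  by (blast intro: has_sum_imp_summable)

definition weight2 :: "nat list \<times> nat list \<Rightarrow> real" where
  "weight2 = (\<lambda>(\<alpha>, \<beta>). weight \<alpha> + weight \<beta>)"

definition weight3 :: "nat list \<times> nat list \<times> int \<Rightarrow> real" where
  "weight3 = (\<lambda>(\<alpha>, \<beta>, n). weight \<alpha> + weight \<beta> + (of_int n)\<^sup>2)"

interpretation one: growth partitions weight
proof
  show "(\<lambda>\<alpha>. exp (- \<epsilon> * weight \<alpha>)) summable_on partitions" if "0 < \<epsilon>" for \<epsilon> :: real
    using that by (rule summable_exp_weight)
qed auto

interpretation two: growth "partitions \<times> partitions" weight2
proof
  fix \<epsilon> :: real assume "0 < \<epsilon>"
  then have "(\<lambda>(\<alpha>, \<beta>). exp (- \<epsilon> * weight \<alpha>) * exp (- \<epsilon> * weight \<beta>)) summable_on partitions \<times> partitions"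
    by (intro summable_on_product_nonneg summable_exp_weight) auto
  then show "(\<lambda>s. exp (- \<epsilon> * weight2 s)) summable_on partitions \<times> partitions"
    by (simp add: weight2_def case_prod_unfold exp_add[symmetric] algebra_simps)
qed (auto simp: weight2_def)

interpretation three: growth "partitions \<times> partitions \<times> UNIV" weight3
proof
  fix \<epsilon> :: real assume "0 < \<epsilon>"
  then have "(\<lambda>(\<alpha>, p). exp (- \<epsilon> * weight \<alpha>) * (case p of (\<beta>, n) \<Rightarrow> exp (- \<epsilon> * weight \<beta>) * exp (- \<epsilon> * (of_int n)\<^sup>2)))
      summable_on partitions \<times> (partitions \<times> (UNIV :: int set))"
    by (intro summable_on_product_nonneg summable_exp_weight summable_exp_square) auto
  then show "(\<lambda>s. exp (- \<epsilon> * weight3 s)) summable_on partitions \<times> partitions \<times> UNIV"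
    by (simp add: weight3_def case_prod_unfold exp_add[symmetric] algebra_simps)
qed (auto simp: weight3_def)

section \<open>Expectations as weighted sums\<close>

lemma has_sum_UNIV_I:
  assumes "(h has_sum c) S" "\<And>x. x \<in> S \<Longrightarrow> g x = h x" "\<And>x. x \<notin> S \<Longrightarrow> g x = 0"
  shows "(g has_sum c) UNIV"
  by (rule has_sum_cong_neutral[THEN iffD1, OF _ _ _ assms(1)]) (use assms(2,3) in auto)

lemma pmf_q_uniform_q_of:
  "0 < t \<Longrightarrow> pmf (q_uniform (q_of t)) \<alpha> = (if is_partition \<alpha> then \<phi> (q_of t) * exp (- t / 2 * weight \<alpha>) else 0)"
  using q_of[of t] by (simp add: pmf_q_uniform q_of_power)

lemma pmf_integer_gaussian_q_of:
  "0 < t \<Longrightarrow> pmf (integer_gaussian (q_of t)) n = exp (- t / 2 * (of_int n)\<^sup>2) / \<theta> (q_of t)"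
  using q_of[of t] by (simp add: pmf_integer_gaussian q_of_powi)

text \<open>Here \<open>w\<close> is the unnormalised mass and \<open>c\<close> its normalising
  constant, which later cancels against the prefactors \<open>1 / \<phi>\<close>,
  \<open>1 / \<phi>\<^sup>2\<close> and \<open>\<theta> / \<phi>\<^sup>2\<close> of the
  coefficients.\<close>

lemma expectation_eq_weighted_sum:
  fixes f :: "'a \<Rightarrow> real"
  assumes "(\<lambda>s. w s * f s) summable_on S" "\<And>s. s \<in> S \<Longrightarrow> pmf p s = c * w s" "\<And>s. s \<notin> S \<Longrightarrow> pmf p s = 0"
  shows "measure_pmf.expectation p f = c * (\<Sum>\<^sub>\<infinity>s\<in>S. w s * f s)"
proof -
  have "((\<lambda>s. c * (w s * f s)) has_sum c * (\<Sum>\<^sub>\<infinity>s\<in>S. w s * f s)) S"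
    by (intro has_sum_cmult_right has_sum_infsum assms)
  then have "((\<lambda>s. pmf p s * f s) has_sum c * (\<Sum>\<^sub>\<infinity>s\<in>S. w s * f s)) UNIV"
    by (rule has_sum_UNIV_I) (auto simp: assms)
  then show ?thesis
    by (subst expectation_infsum) (auto simp: has_sum_iff)
qed

lemma expectation_q_uniform:
  assumes t: "t > 0" and f: "one.poly_bounded f"
  shows "measure_pmf.expectation (q_uniform (q_of t)) f
    = \<phi> (q_of t) * (\<Sum>\<^sub>\<infinity>\<alpha>\<in>partitions. exp (- t / 2 * weight \<alpha>) * f \<alpha>)"
proof (rule expectation_eq_weighted_sum)
  show "(\<lambda>\<alpha>. exp (- t / 2 * weight \<alpha>) * f \<alpha>) summable_on partitions"
    using one.summable_exp_poly_bounded[OF _ f, of "t / 2"] t by simp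
qed (use t in \<open>auto simp: pmf_q_uniform_q_of\<close>)

lemma expectation_q_uniform2:
  assumes t: "t > 0" and f: "two.poly_bounded f"
  shows "measure_pmf.expectation (pair_pmf (q_uniform (q_of t)) (q_uniform (q_of t))) f
    = (\<phi> (q_of t))\<^sup>2 * (\<Sum>\<^sub>\<infinity>s\<in>partitions \<times> partitions. exp (- t / 2 * weight2 s) * f s)"
proof (rule expectation_eq_weighted_sum)
  show "(\<lambda>s. exp (- t / 2 * weight2 s) * f s) summable_on partitions \<times> partitions"
    using two.summable_exp_poly_bounded[OF _ f, of "t / 2"] t by simp
  fix s :: "nat list \<times> nat list"
  obtain \<alpha> \<beta> where s: "s = (\<alpha>, \<beta>)" by (cases s)
  show "pmf (pair_pmf (q_uniform (q_of t)) (q_uniform (q_of t))) s = (\<phi> (q_of t))\<^sup>2 * exp (- t / 2 * weight2 s)"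
    if "s \<in> partitions \<times> partitions"
    using that unfolding s weight2_def prod.case distrib_left exp_add pmf_pair pmf_q_uniform_q_of[OF t]
    by (simp add: power2_eq_square)
  show "pmf (pair_pmf (q_uniform (q_of t)) (q_uniform (q_of t))) s = 0" if "s \<notin> partitions \<times> partitions"
    using that by (auto simp: s pmf_pair pmf_q_uniform_q_of[OF t])
qed

lemma expectation_q_uniform3:
  assumes t: "t > 0" and f: "three.poly_bounded f"
  shows "measure_pmf.expectation (pair_pmf (q_uniform (q_of t)) (pair_pmf (q_uniform (q_of t)) (integer_gaussian (q_of t)))) f
    = (\<phi> (q_of t))\<^sup>2 / \<theta> (q_of t) * (\<Sum>\<^sub>\<infinity>s\<in>partitions \<times> partitions \<times> UNIV. exp (- t / 2 * weight3 s) * f s)"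
proof (rule expectation_eq_weighted_sum)
  show "(\<lambda>s. exp (- t / 2 * weight3 s) * f s) summable_on partitions \<times> partitions \<times> UNIV"
    using three.summable_exp_poly_bounded[OF _ f, of "t / 2"] t by simp
  let ?p = "pair_pmf (q_uniform (q_of t)) (pair_pmf (q_uniform (q_of t)) (integer_gaussian (q_of t)))"
  fix s :: "nat list \<times> nat list \<times> int"
  obtain \<alpha> \<beta> n where s: "s = (\<alpha>, \<beta>, n)" by (cases s)
  show "pmf ?p s = (\<phi> (q_of t))\<^sup>2 / \<theta> (q_of t) * exp (- t / 2 * weight3 s)"
    if "s \<in> partitions \<times> partitions \<times> UNIV"
    using that unfolding s weight3_def prod.case distrib_left exp_add pmf_pair
      pmf_q_uniform_q_of[OF t] pmf_integer_gaussian_q_of[OF t]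
    by (simp add: power2_eq_square)
  show "pmf ?p s = 0" if "s \<notin> partitions \<times> partitions \<times> UNIV"
    using that by (auto simp: s pmf_pair pmf_q_uniform_q_of[OF t])
qed

lemma conjugate_weights:
  assumes "is_partition \<alpha>"
  shows "K (conjugate \<alpha>) = - K \<alpha>" "weight (conjugate \<alpha>) = weight \<alpha>"
  using assms by (simp_all add: total_content_conjugate sum_list_conjugate)

lemma infsum_odd_eq_0:
  fixes f :: "'a \<Rightarrow> real"
  assumes "bij_betw g S S" "\<And>s. s \<in> S \<Longrightarrow> f (g s) = - f s"
  shows "infsum f S = 0"
proof -
  have "infsum f S = (\<Sum>\<^sub>\<infinity>s\<in>S. f (g s))"
    by (rule infsum_reindex_bij_betw[OF assms(1), symmetric])
  also have "\<dots> = (\<Sum>\<^sub>\<infinity>s\<in>S. - f s)"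
    by (intro infsum_cong assms)
  also have "\<dots> = - infsum f S"
    by (rule infsum_uminus)
  finally show ?thesis by simp
qed

section \<open>Polynomial bounds and uniform exponent bounds\<close>

lemma abs_content_le_add:
  assumes "is_partition \<alpha>" "0 \<le> x"
  shows "\<bar>K \<alpha>\<bar> \<le> 1 * (1 + (weight \<alpha> + x))\<^sup>2"
proof -
  have "(weight \<alpha>)\<^sup>2 \<le> (1 + (weight \<alpha> + x))\<^sup>2" using assms(2) by (intro power_mono) auto
  with abs_content_le[OF assms(1)] show ?thesis by linarith
qed

lemma poly_bounded_one:
  "one.poly_bounded K" "one.poly_bounded weight"
proof -
  show "one.poly_bounded K"
    using abs_content_le_add[of _ 0] by (intro one.poly_boundedI[of _ 1 2]) auto
  show "one.poly_bounded weight"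
    by (rule one.poly_boundedI[of _ 1 1]) auto
qed

lemma poly_bounded_two:
  "two.poly_bounded (\<lambda>s. K (fst s))" "two.poly_bounded (\<lambda>s. K (snd s))"
  "two.poly_bounded (\<lambda>s. weight (fst s) - weight (snd s))"
proof -
  show "two.poly_bounded (\<lambda>s. K (fst s))"
  proof (rule two.poly_boundedI[of _ 1 2])
    fix s assume "s \<in> partitions \<times> partitions"
    then show "\<bar>K (fst s)\<bar> \<le> 1 * (1 + weight2 s)\<^sup>2"
      using abs_content_le_add[of "fst s" "weight (snd s)"] by (auto simp: weight2_def)
  qed
  show "two.poly_bounded (\<lambda>s. K (snd s))"
  proof (rule two.poly_boundedI[of _ 1 2])
    fix s assume "s \<in> partitions \<times> partitions"
    then show "\<bar>K (snd s)\<bar> \<le> 1 * (1 + weight2 s)\<^sup>2"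
      using abs_content_le_add[of "snd s" "weight (fst s)"] by (auto simp: weight2_def add.commute)
  qed
  show "two.poly_bounded (\<lambda>s. weight (fst s) - weight (snd s))"
    by (rule two.poly_boundedI[of _ 1 1]) (auto simp: weight2_def)
qed

text \<open>The constant 3 counts the two contents and the mixed term, each at most
  \<open>(1 + weight3 s)\<^sup>2\<close>; the integer is controlled through
  \<open>\<bar>n\<bar> \<le> 1 + n\<^sup>2\<close>.\<close>

lemma poly_bounded_three:
  "three.poly_bounded (\<lambda>(\<alpha>, \<beta>, n). K \<alpha> + K \<beta> + of_int n * (weight \<alpha> - weight \<beta>))"
proof (rule three.poly_boundedI[of _ 3 2])
  fix s :: "nat list \<times> nat list \<times> int" assume "s \<in> partitions \<times> partitions \<times> UNIV"
  then obtain \<alpha> \<beta> n where s: "s = (\<alpha>, \<beta>, n)" "is_partition \<alpha>" "is_partition \<beta>" by auto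
  define x y z where "x = weight \<alpha>" and "y = weight \<beta>" and "z = (real_of_int n)\<^sup>2"
  have xyz: "0 \<le> x" "0 \<le> y" "0 \<le> z" by (auto simp: x_def y_def z_def)
  have n: "\<bar>real_of_int n\<bar> \<le> 1 + (x + y + z)"
  proof -
    have "0 \<le> (\<bar>real_of_int n\<bar> - 1)\<^sup>2" by simp
    then have "2 * \<bar>real_of_int n\<bar> \<le> 1 + z" by (simp add: z_def power2_diff)
    then show ?thesis using xyz by linarith
  qed
  have "\<bar>x - y\<bar> \<le> 1 + (x + y + z)" using xyz by linarith
  with n have "\<bar>real_of_int n\<bar> * \<bar>x - y\<bar> \<le> (1 + (x + y + z)) * (1 + (x + y + z))"
    using xyz by (intro mult_mono) auto
  moreover have "\<bar>K \<alpha>\<bar> \<le> (1 + (x + y + z))\<^sup>2"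
    using abs_content_le_add[OF s(2), of "y + z"] xyz by (simp add: x_def add.assoc)
  moreover have "\<bar>K \<beta>\<bar> \<le> (1 + (x + y + z))\<^sup>2"
    using abs_content_le_add[OF s(3), of "x + z"] xyz by (simp add: y_def add.assoc add.left_commute)
  ultimately have "\<bar>K \<alpha> + K \<beta> + of_int n * (x - y)\<bar> \<le> 3 * (1 + (x + y + z))\<^sup>2"
    by (simp add: abs_mult[symmetric] power2_eq_square[of "1 + (x + y + z)"])
  then show "\<bar>case s of (\<alpha>, \<beta>, n) \<Rightarrow> K \<alpha> + K \<beta> + of_int n * (weight \<alpha> - weight \<beta>)\<bar> \<le> 3 * (1 + weight3 s)\<^sup>2"
    by (simp add: s weight3_def x_def y_def z_def)
qed

text \<open>In the extreme case \<open>c = - (1 / 2)\<close> the surplus in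
  \<open>content_ge_linear\<close> cancels the shift exactly and leaves
  \<open>length \<alpha> * weight \<alpha> / 2\<close>, at most
  \<open>N * weight \<alpha> / 4\<close>.\<close>

lemma content_exponent_bound:
  assumes t: "0 < t" and \<alpha>: "\<alpha> \<in> short_partitions r" and r: "2 * r \<le> N" "0 < N" and c: "- (1 / 2) \<le> c"
  shows "- t * (K \<alpha> + c * weight \<alpha>) / real N \<le> t / 4 * weight \<alpha>"
proof -
  have \<alpha>': "is_partition \<alpha>" and "2 * real (length \<alpha>) \<le> real N"
    using \<alpha> r by (auto simp: short_partitions_def)
  then have "2 * real (length \<alpha>) * weight \<alpha> \<le> real N * weight \<alpha>"
    by (intro mult_right_mono) auto
  moreover have "- (1 / 2) * weight \<alpha> \<le> c * weight \<alpha>"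
    using c by (intro mult_right_mono) auto
  ultimately have "- (K \<alpha> + c * weight \<alpha>) \<le> real N * weight \<alpha> / 4"
    using content_ge_linear[OF \<alpha>'] by (simp add: algebra_simps)
  then have "t * (- (K \<alpha> + c * weight \<alpha>)) \<le> t * (real N * weight \<alpha> / 4)"
    using t by (intro mult_left_mono) auto
  then show ?thesis using r by (simp add: field_simps)
qed

text \<open>Length at least \<open>r + 1\<close> forces size at least \<open>r + 1\<close>. The
  slack in \<open>N \<le> 2 * r + 2\<close> admits \<open>r = N / 2 - 1\<close>, which occurs in
  type \<open>D\<close> and, for even \<open>N\<close>, above the pivot in types \<open>A'\<close>
  and \<open>A\<close>.\<close>

lemma short_partitions_exhaust:
  assumes "is_partition \<alpha>" "\<alpha> \<notin> short_partitions r" "N \<le> 2 * r + 2"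
  shows "real N \<le> 2 * weight \<alpha>"
proof -
  have "Suc r \<le> length \<alpha>" using assms by (auto simp: short_partitions_def)
  then have "N \<le> 2 * sum_list \<alpha>" using length_le_sum_list[OF assms(1)] assms(3) by linarith
  then have "real N \<le> real (2 * sum_list \<alpha>)" by (simp only: of_nat_le_iff)
  then show ?thesis by simp
qed

section \<open>Types \<open>B\<close>, \<open>C\<close> and \<open>D\<close>\<close>

definition one_coeff :: "real \<Rightarrow> nat \<Rightarrow> real \<Rightarrow> real" where
  "one_coeff c k t = (- t) ^ k / (\<phi> (q_of t) * fact k) *
     measure_pmf.expectation (q_uniform (q_of t)) (\<lambda>\<alpha>. (K \<alpha> + c * weight \<alpha>) ^ k)"

text \<open>The bound \<open>r\<close> on the length is left open because type \<open>D\<close>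
  takes it both as \<open>N div 2\<close> and as \<open>N div 2 - 1\<close>; the coefficients do not
  depend on this choice.\<close>

lemma one_expansion:
  assumes t: "0 < t" and c: "- (1 / 2) \<le> c"
    and r: "\<And>N. P N \<Longrightarrow> 2 * r N \<le> N \<and> N \<le> 2 * r N + 2"
  shows "(\<lambda>N. (\<Sum>\<^sub>\<infinity>\<alpha>\<in>short_partitions (r N). exp (- t / 2 * weight \<alpha> + - t * (K \<alpha> + c * weight \<alpha>) / real N))
      - (\<Sum>k = 0..p. one_coeff c k t / real N ^ k))
    \<in> O[inf sequentially (principal {N. P N})](\<lambda>N. 1 / real N ^ (p + 1))"
proof -
  define X where "X = (\<lambda>\<alpha>. K \<alpha> + c * weight \<alpha>)"
  have X: "one.poly_bounded X"
    unfolding X_def by (intro one.poly_bounded_intros poly_bounded_one)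
  define d where "d = (\<lambda>i j. \<Sum>\<^sub>\<infinity>\<alpha>\<in>partitions. exp (- t / 2 * weight \<alpha>) * ((- t * X \<alpha>) ^ i / fact i * (0 ^ j / fact j)))"
  have d: "d k 0 = one_coeff c k t" for k
  proof -
    have "d k 0 = (\<Sum>\<^sub>\<infinity>\<alpha>\<in>partitions. (- t) ^ k / fact k * (exp (- t / 2 * weight \<alpha>) * X \<alpha> ^ k))"
      unfolding d_def by (intro infsum_cong) (simp add: power_mult_distrib[symmetric])
    also have "\<dots> = (- t) ^ k / fact k * (\<Sum>\<^sub>\<infinity>\<alpha>\<in>partitions. exp (- t / 2 * weight \<alpha>) * X \<alpha> ^ k)"
      by (rule infsum_cmult_right')
    also have "\<dots> = one_coeff c k t"
      using expectation_q_uniform[OF t one.poly_bounded_power[OF X], of k] euler_factors(3)[of "q_of t"] q_of[OF t]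
      by (simp add: one_coeff_def X_def)
    finally show ?thesis .
  qed
  have sum_d: "(\<Sum>(i, j) | i + 2 * j \<le> p. d i j / real N ^ (i + 2 * j)) = (\<Sum>k = 0..p. one_coeff c k t / real N ^ k)" for N
    by (subst sum_two_scale_no_b) (simp_all add: d, simp add: d_def zero_power)
  have "(\<lambda>N. (\<Sum>\<^sub>\<infinity>\<alpha>\<in>short_partitions (r N). exp (- t / 2 * weight \<alpha> + - t * X \<alpha> / real N))
      - (\<Sum>(i, j) | i + 2 * j \<le> p. d i j / real N ^ (i + 2 * j)))
      \<in> O[inf sequentially (principal {N. P N})](\<lambda>N. 1 / real N ^ Suc p)"
    unfolding d_def
  proof (rule one.two_scale_expansion[OF t, where D = "\<lambda>N. short_partitions (r N)"])
    show "one.poly_bounded (\<lambda>\<alpha>. - t * X \<alpha>)" "one.poly_bounded (\<lambda>_. 0)"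
      by (intro one.poly_bounded_intros X)+
    show "short_partitions (r N) \<subseteq> partitions" for N by (auto simp: short_partitions_def)
    show "real N \<le> 2 * (1 + weight \<alpha>)" if "P N" "\<alpha> \<in> partitions" "\<alpha> \<notin> short_partitions (r N)" for N \<alpha>
      using short_partitions_exhaust[of \<alpha> "r N" N] r[OF that(1)] that by simp
    show "- t * X \<alpha> / real N + 0 / (real N)\<^sup>2 \<le> t / 4 * weight \<alpha>"
      if "P N" "0 < N" "\<alpha> \<in> short_partitions (r N)" for N \<alpha>
      using content_exponent_bound[OF t that(3) _ that(2) c] r[OF that(1)] by (simp add: X_def)
  qed simp
  then show ?thesis unfolding sum_d by (simp add: X_def)
qed

lemma bigo_eventually_eq:
  assumes "g \<in> O[F](h)" "eventually (\<lambda>x. f x = g x) F"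
  shows "f \<in> O[F](h)"
  using assms landau_o.big.in_cong[of f g F h] by blast

lemma coeff_BD_eq: "coeff_BD k t = one_coeff (- (1 / 2)) k t"
  by (simp add: coeff_BD_def one_coeff_def)

lemma coeff_C_eq: "coeff_C k t = one_coeff (1 / 2) k t"
  by (simp add: coeff_C_def one_coeff_def)

lemma expansion_B:
  assumes t: "0 < t"
  shows "(\<lambda>N. heat_trace Type_B N t - (\<Sum>k = 0..p. coeff_BD k t / real N ^ k))
    \<in> O[along Type_B](\<lambda>N. 1 / real N ^ (p + 1))"
proof -
  have "(\<lambda>N. (\<Sum>\<^sub>\<infinity>\<alpha>\<in>short_partitions (N div 2). exp (- t / 2 * weight \<alpha> + - t * (K \<alpha> + - (1 / 2) * weight \<alpha>) / real N))
      - (\<Sum>k = 0..p. one_coeff (- (1 / 2)) k t / real N ^ k)) \<in> O[along Type_B](\<lambda>N. 1 / real N ^ (p + 1))"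
    unfolding along_def by (rule one_expansion[OF t]) auto
  then show ?thesis
    unfolding coeff_BD_eq
    by (rule bigo_eventually_eq)
      (auto simp: along_def eventually_inf_principal heat_trace_B)
qed

lemma expansion_C:
  assumes t: "0 < t"
  shows "(\<lambda>N. heat_trace Type_C N t - (\<Sum>k = 0..p. coeff_C k t / real N ^ k))
    \<in> O[along Type_C](\<lambda>N. 1 / real N ^ (p + 1))"
proof -
  have "(\<lambda>N. (\<Sum>\<^sub>\<infinity>\<alpha>\<in>short_partitions (N div 2). exp (- t / 2 * weight \<alpha> + - t * (K \<alpha> + 1 / 2 * weight \<alpha>) / real N))
      - (\<Sum>k = 0..p. one_coeff (1 / 2) k t / real N ^ k)) \<in> O[along Type_C](\<lambda>N. 1 / real N ^ (p + 1))"
    unfolding along_def by (rule one_expansion[OF t]) auto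
  then show ?thesis
    unfolding coeff_C_eq
    by (rule bigo_eventually_eq)
      (auto simp: along_def eventually_inf_principal heat_trace_C)
qed

text \<open>By \<open>heat_trace_D\<close> the trace is twice one sum minus another. Both have the
  same expansion as in type \<open>B\<close>, so one copy of it remains.\<close>

lemma expansion_D:
  assumes t: "0 < t"
  shows "(\<lambda>N. heat_trace Type_D N t - (\<Sum>k = 0..p. coeff_BD k t / real N ^ k))
    \<in> O[along Type_D](\<lambda>N. 1 / real N ^ (p + 1))"
proof -
  define f where "f = (\<lambda>N \<alpha>. exp (- t / 2 * weight \<alpha> + - t * (K \<alpha> + - (1 / 2) * weight \<alpha>) / real N))"
  define c where "c = (\<lambda>N. \<Sum>k = 0..p. one_coeff (- (1 / 2)) k t / real N ^ k)"
  have 1: "(\<lambda>N. infsum (f N) (short_partitions (N div 2)) - c N) \<in> O[along Type_D](\<lambda>N. 1 / real N ^ (p + 1))"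
    unfolding along_def f_def c_def by (rule one_expansion[OF t]) auto
  have 2: "(\<lambda>N. infsum (f N) (short_partitions (N div 2 - 1)) - c N) \<in> O[along Type_D](\<lambda>N. 1 / real N ^ (p + 1))"
    unfolding along_def f_def c_def by (rule one_expansion[OF t]) auto
  have "(\<lambda>N. (infsum (f N) (short_partitions (N div 2)) - c N) + (infsum (f N) (short_partitions (N div 2)) - c N) - (infsum (f N) (short_partitions (N div 2 - 1)) - c N))
      \<in> O[along Type_D](\<lambda>N. 1 / real N ^ (p + 1))"
    by (rule sum_in_bigo(2)[OF sum_in_bigo(1)[OF 1 1] 2])
  then show ?thesis
    unfolding coeff_BD_eq
  proof (rule bigo_eventually_eq)
    have "heat_trace Type_D N t = 2 * infsum (f N) (short_partitions (N div 2)) - infsum (f N) (short_partitions (N div 2 - 1))"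
      if N: "even N" "2 \<le> N" for N
    proof (rule heat_trace_D)
      have sub: "short_partitions (N div 2) \<subseteq> partitions" by (auto simp: short_partitions_def)
      \<comment> \<open>The exponent bound, applied at fixed \<open>N\<close>, also provides the
        convergence that \<open>heat_trace_D\<close> assumes.\<close>
      have "(\<lambda>\<alpha>. norm (f N \<alpha>)) summable_on short_partitions (N div 2)"
      proof (rule abs_summable_on_dominated)
        show "(\<lambda>\<alpha>. exp (- (t / 4) * weight \<alpha>)) summable_on short_partitions (N div 2)"
          using t by (intro summable_on_subset_banach[OF summable_exp_weight sub]) simp
        show "\<bar>f N \<alpha>\<bar> \<le> exp (- (t / 4) * weight \<alpha>)" if "\<alpha> \<in> short_partitions (N div 2)" for \<alpha>
        proof -
          have "- t / 2 * weight \<alpha> + e \<le> - (t / 4) * weight \<alpha>" if "e \<le> t / 4 * weight \<alpha>" for e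
            using that by (simp add: field_simps)
          from this[OF content_exponent_bound[OF t that, of N "- (1 / 2)"]] show ?thesis
            unfolding f_def abs_exp_cancel exp_le_cancel_iff using N by simp
        qed
      qed
      then show "f N summable_on short_partitions (N div 2)" by (rule abs_summable_summable)
    qed (use N in \<open>auto simp: f_def\<close>)
    then show "eventually (\<lambda>N. heat_trace Type_D N t - (\<Sum>k = 0..p. one_coeff (- (1 / 2)) k t / real N ^ k)
        = (infsum (f N) (short_partitions (N div 2)) - c N) + (infsum (f N) (short_partitions (N div 2)) - c N) - (infsum (f N) (short_partitions (N div 2 - 1)) - c N)) (along Type_D)"
      by (auto simp: along_def eventually_inf_principal c_def)
  qed
qed

section \<open>Types \<open>A'\<close> and \<open>A\<close>\<close>

text \<open>The reserves \<open>2 * (weight \<alpha>)\<^sup>2 / N\<close> and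
  \<open>2 * (weight \<beta>)\<^sup>2 / N\<close> pay for the squared difference of the sizes, which
  is at most the sum of their squares because sizes are nonnegative. \<open>SU(N)\<close> asks for
  half of this square; completing the square for \<open>U(N)\<close> uses all of it.\<close>

lemma pair_exponent_bound:
  assumes \<alpha>: "\<alpha> \<in> short_partitions a" and \<beta>: "\<beta> \<in> short_partitions b"
    and ab: "2 * a \<le> N" "2 * b \<le> N" "0 < N"
  shows "- (K \<alpha> + K \<beta>) / real N + (weight \<alpha> - weight \<beta>)\<^sup>2 / (real N)\<^sup>2 \<le> (weight \<alpha> + weight \<beta>) / 4"
proof -
  define x where "x = real N"
  have x: "0 < x" using ab by (simp add: x_def)
  have "2 * (weight \<alpha>)\<^sup>2 / x - x / 2 * weight \<alpha> \<le> 2 * K \<alpha>"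
    unfolding x_def by (rule content_ge_quadratic) (use \<alpha> ab in \<open>auto simp: short_partitions_def\<close>)
  moreover have "2 * (weight \<beta>)\<^sup>2 / x - x / 2 * weight \<beta> \<le> 2 * K \<beta>"
    unfolding x_def by (rule content_ge_quadratic) (use \<beta> ab in \<open>auto simp: short_partitions_def\<close>)
  moreover have "(weight \<alpha> - weight \<beta>)\<^sup>2 / x \<le> (weight \<alpha>)\<^sup>2 / x + (weight \<beta>)\<^sup>2 / x"
    using x by (simp add: add_divide_distrib[symmetric] divide_right_mono power2_diff)
  ultimately have "- (K \<alpha> + K \<beta>) + (weight \<alpha> - weight \<beta>)\<^sup>2 / x \<le> x * ((weight \<alpha> + weight \<beta>) / 4)"
    by (simp add: field_simps)
  then have "(- (K \<alpha> + K \<beta>) + (weight \<alpha> - weight \<beta>)\<^sup>2 / x) / x \<le> (weight \<alpha> + weight \<beta>) / 4"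
    using x by (simp add: pos_divide_le_eq mult.commute)
  then show ?thesis
    by (simp add: add_divide_distrib power2_eq_square x_def)
qed

lemma triple_exponent_bound:
  assumes \<alpha>: "\<alpha> \<in> short_partitions a" and \<beta>: "\<beta> \<in> short_partitions b"
    and ab: "2 * a \<le> N" "2 * b \<le> N" "0 < N"
  shows "- (K \<alpha> + K \<beta> + y * (weight \<alpha> - weight \<beta>)) / real N \<le> (weight \<alpha> + weight \<beta> + y\<^sup>2) / 4"
proof -
  \<comment> \<open>Completing the square splits the mixed term into \<open>y\<^sup>2 / 4\<close>,
    the share of the integer in the bound, and the squared difference covered by
    \<open>pair_exponent_bound\<close>.\<close>
  have "0 \<le> (y / 2 + (weight \<alpha> - weight \<beta>) / real N)\<^sup>2" by simp
  then have "- (y * (weight \<alpha> - weight \<beta>)) / real N \<le> y\<^sup>2 / 4 + (weight \<alpha> - weight \<beta>)\<^sup>2 / (real N)\<^sup>2"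
    by (simp add: power2_sum power_divide)
  with pair_exponent_bound[OF assms] show ?thesis
    by (simp add: add_divide_distrib diff_divide_distrib)
qed

lemma length_bounds:
  fixes N :: nat
  assumes "0 < N"
  shows "2 * ((N + 1) div 2 - 1) \<le> N" "2 * (N div 2) \<le> N"
    "N \<le> 2 * ((N + 1) div 2 - 1) + 2" "N \<le> 2 * (N div 2) + 2"
  using assms by presburger+

lemma expansion_A':
  assumes t: "0 < t"
  shows "(\<lambda>N. heat_trace Type_A' N t - (\<Sum>k = 0..p. even_coeff_A' k t / real N ^ (2 * k)))
    \<in> O[along Type_A'](\<lambda>N. 1 / real N ^ (2 * p + 2))"
proof -
  define X where "X = (\<lambda>(\<alpha>, \<beta>, n). K \<alpha> + K \<beta> + real_of_int n * (weight \<alpha> - weight \<beta>))"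
  define S where "S = partitions \<times> partitions \<times> (UNIV :: int set)"
  have X: "three.poly_bounded X" unfolding X_def by (rule poly_bounded_three)
  define d where "d = (\<lambda>i j. \<Sum>\<^sub>\<infinity>s\<in>S. exp (- t / 2 * weight3 s) * ((- t * X s) ^ i / fact i * (0 ^ j / fact j)))"
  define m where "m = (\<lambda>k. \<Sum>\<^sub>\<infinity>s\<in>S. exp (- t / 2 * weight3 s) * X s ^ k)"
  have d0: "d k 0 = (- t) ^ k / fact k * m k" for k
  proof -
    have "d k 0 = (\<Sum>\<^sub>\<infinity>s\<in>S. (- t) ^ k / fact k * (exp (- t / 2 * weight3 s) * X s ^ k))"
      unfolding d_def by (intro infsum_cong) (simp add: power_mult_distrib[symmetric])
    also have "\<dots> = (- t) ^ k / fact k * m k"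
      unfolding m_def by (rule infsum_cmult_right')
    finally show ?thesis .
  qed
  have m_odd: "m k = 0" if "odd k" for k
    unfolding m_def
  proof (rule infsum_odd_eq_0)
    \<comment> \<open>The integer must change sign together with the contents: sizes are invariant
      under conjugation, so only then does the mixed term in \<open>X\<close> flip as well.\<close>
    show "bij_betw (\<lambda>(\<alpha>, \<beta>, n). (conjugate \<alpha>, conjugate \<beta>, - n)) S S"
      unfolding S_def
      by (rule bij_betwI[where g = "\<lambda>(\<alpha>, \<beta>, n). (conjugate \<alpha>, conjugate \<beta>, - n)"])
        (auto simp: is_partition_conjugate conjugate_conjugate)
    fix s assume "s \<in> S"
    then obtain \<alpha> \<beta> n where s: "s = (\<alpha>, \<beta>, n)" "is_partition \<alpha>" "is_partition \<beta>"
      by (auto simp: S_def)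
    have "weight3 (conjugate \<alpha>, conjugate \<beta>, - n) = weight3 (\<alpha>, \<beta>, n)"
      by (simp add: weight3_def conjugate_weights s)
    moreover have "X (conjugate \<alpha>, conjugate \<beta>, - n) = - X (\<alpha>, \<beta>, n)"
      by (simp add: X_def conjugate_weights s)
    ultimately show "exp (- t / 2 * weight3 (case s of (\<alpha>, \<beta>, n) \<Rightarrow> (conjugate \<alpha>, conjugate \<beta>, - n)))
        * X (case s of (\<alpha>, \<beta>, n) \<Rightarrow> (conjugate \<alpha>, conjugate \<beta>, - n)) ^ k
      = - (exp (- t / 2 * weight3 s) * X s ^ k)"
      using that by (simp add: s)
  qed
  have d_pos: "d i j = 0" if "0 < j" for i j
    using that by (simp add: d_def zero_power)
  have d_odd: "d i j = 0" if "odd i" for i j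
    by (cases "j = 0") (use that in \<open>simp_all add: d0 m_odd d_pos\<close>)
  have m_even: "even_coeff_A' k t = d (2 * k) 0" for k
    using expectation_q_uniform3[OF t three.poly_bounded_power[OF X], of "2 * k"]
      euler_factors(3)[of "q_of t"] theta_pos[of "q_of t"] q_of[OF t]
    by (simp add: even_coeff_A'_def d0 m_def S_def X_def case_prod_unfold field_simps)
  have sum_d: "(\<Sum>(i, j) | i + 2 * j \<le> 2 * p + 1. d i j / real N ^ (i + 2 * j))
      = (\<Sum>k = 0..p. even_coeff_A' k t / real N ^ (2 * k))" for N
  proof -
    have "(\<Sum>i\<le>k. d (2 * i) (k - i)) = even_coeff_A' k t" for k
    proof -
      have "(\<Sum>i\<le>k. d (2 * i) (k - i)) = (\<Sum>i\<in>{k}. d (2 * i) (k - i))"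
        by (rule sum.mono_neutral_right) (auto intro!: d_pos)
      then show ?thesis by (simp add: m_even)
    qed
    then show ?thesis
      using sum_two_scale_even[where c = d and x = "real N" and p = p, OF d_odd] by simp
  qed
  define D where "D = (\<lambda>N. short_partitions ((N + 1) div 2 - 1) \<times> short_partitions (N div 2) \<times> (UNIV :: int set))"
  have "(\<lambda>N. heat_trace Type_A' N t - (\<Sum>(i, j) | i + 2 * j \<le> 2 * p + 1. d i j / real N ^ (i + 2 * j)))
      \<in> O[along Type_A'](\<lambda>N. 1 / real N ^ Suc (2 * p + 1))"
    unfolding d_def along_def S_def
  proof (rule three.two_scale_expansion[OF t, where D = D])
    show "three.poly_bounded (\<lambda>s. - t * X s)" "three.poly_bounded (\<lambda>_. 0)"
      by (intro three.poly_bounded_intros X)+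
    show "D N \<subseteq> partitions \<times> partitions \<times> UNIV" for N by (auto simp: D_def short_partitions_def)
    fix N assume "admissible Type_A' N"
    then have N: "0 < N" by simp
    note lb = length_bounds[OF N]
    show "heat_trace Type_A' N t = (\<Sum>\<^sub>\<infinity>s\<in>D N. exp (- t / 2 * weight3 s + - t * X s / real N + 0 / (real N)\<^sup>2))"
      unfolding heat_trace_A'[OF N] D_def by (simp add: weight3_def X_def case_prod_unfold)
    show "real N \<le> 2 * (1 + weight3 s)" if s_in: "s \<in> partitions \<times> partitions \<times> UNIV" and s_out: "s \<notin> D N" for s
    proof -
      obtain \<alpha> \<beta> n where s: "s = (\<alpha>, \<beta>, n)" "is_partition \<alpha>" "is_partition \<beta>" using s_in by (cases s) auto
      then have "\<alpha> \<notin> short_partitions ((N + 1) div 2 - 1) \<or> \<beta> \<notin> short_partitions (N div 2)"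
        using s_out by (auto simp: D_def)
      then consider "real N \<le> 2 * weight \<alpha>" | "real N \<le> 2 * weight \<beta>"
        using short_partitions_exhaust[OF s(2) _ lb(3)] short_partitions_exhaust[OF s(3) _ lb(4)] by blast
      then have "real N \<le> 2 * weight \<alpha> + 2 * weight \<beta>" by cases auto
      moreover have "0 \<le> (real_of_int n)\<^sup>2" by auto
      ultimately show ?thesis
        unfolding s weight3_def prod.case by argo
    qed
    show "- t * X s / real N + 0 / (real N)\<^sup>2 \<le> t / 4 * weight3 s" if "s \<in> D N" for s
    proof -
      obtain \<alpha> \<beta> n where s: "s = (\<alpha>, \<beta>, n)" "\<alpha> \<in> short_partitions ((N + 1) div 2 - 1)" "\<beta> \<in> short_partitions (N div 2)"
        using \<open>s \<in> D N\<close> by (auto simp: D_def)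
      have "- X s / real N \<le> weight3 s / 4"
        using triple_exponent_bound[OF s(2,3) lb(1,2) N, of "of_int n"] by (simp add: s(1) X_def weight3_def)
      then have "t * (- X s / real N) \<le> t * (weight3 s / 4)"
        using t by (intro mult_left_mono) auto
      then show ?thesis by simp
    qed
  qed
  then show ?thesis unfolding sum_d by simp
qed

lemma expansion_A:
  assumes t: "0 < t"
  shows "(\<lambda>N. heat_trace Type_A N t - (\<Sum>k = 0..p. even_coeff_A k t / real N ^ (2 * k)))
    \<in> O[along Type_A](\<lambda>N. 1 / real N ^ (2 * p + 2))"
proof -
  define S where "S = partitions \<times> partitions"
  define X where "X = (\<lambda>s. K (fst s) + K (snd s))"
  define Y where "Y = (\<lambda>s. (weight (fst s) - weight (snd s) :: real))"
  \<comment> \<open>Moments are kept separate in the two contents because the coefficients contain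
    only even powers of each; parity of their sum would not show this.\<close>
  define mom where "mom = (\<lambda>u v l. \<Sum>\<^sub>\<infinity>s\<in>S. exp (- t / 2 * weight2 s) * (K (fst s) ^ u * K (snd s) ^ v * Y s ^ (2 * l)))"
  define d where "d = (\<lambda>i j. \<Sum>\<^sub>\<infinity>s\<in>S. exp (- t / 2 * weight2 s) * ((- t * X s) ^ i / fact i * ((t / 2 * (Y s)\<^sup>2) ^ j / fact j)))"
  have pb: "two.poly_bounded (\<lambda>s. K (fst s) ^ u * K (snd s) ^ v * Y s ^ (2 * l))" for u v l
    unfolding Y_def by (intro two.poly_bounded_intros poly_bounded_two)
  have mom_has_sum: "((\<lambda>s. exp (- t / 2 * weight2 s) * (K (fst s) ^ u * K (snd s) ^ v * Y s ^ (2 * l))) has_sum mom u v l) S" for u v l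
    unfolding mom_def S_def using two.summable_exp_poly_bounded[OF _ pb, of "t / 2"] t
    by (intro has_sum_infsum) simp
  have d_eq: "d i j = (- t) ^ i * (t / 2) ^ j / fact j * (\<Sum>u\<le>i. mom u (i - u) j / (fact u * fact (i - u)))" for i j
  proof -
    have "((\<lambda>s. \<Sum>u\<le>i. (- t) ^ i * (t / 2) ^ j / fact j / (fact u * fact (i - u)) *
          (exp (- t / 2 * weight2 s) * (K (fst s) ^ u * K (snd s) ^ (i - u) * Y s ^ (2 * j))))
        has_sum (\<Sum>u\<le>i. (- t) ^ i * (t / 2) ^ j / fact j / (fact u * fact (i - u)) * mom u (i - u) j)) S"
      by (intro has_sum_finite_sum has_sum_cmult_right mom_has_sum) simp
    also have "(\<lambda>s. \<Sum>u\<le>i. (- t) ^ i * (t / 2) ^ j / fact j / (fact u * fact (i - u)) *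
          (exp (- t / 2 * weight2 s) * (K (fst s) ^ u * K (snd s) ^ (i - u) * Y s ^ (2 * j))))
        = (\<lambda>s. exp (- t / 2 * weight2 s) * ((- t * X s) ^ i / fact i * ((t / 2 * (Y s)\<^sup>2) ^ j / fact j)))"
    proof
      fix s
      have "(- t * X s) ^ i / fact i = (- t) ^ i * (\<Sum>u\<le>i. (K (fst s) ^ u / fact u) * (K (snd s) ^ (i - u) / fact (i - u)))"
        unfolding X_def power_add_div_fact[symmetric] by (simp only: power_mult_distrib times_divide_eq_right)
      moreover have "(t / 2 * (Y s)\<^sup>2) ^ j = (t / 2) ^ j * Y s ^ (2 * j)"
        by (simp only: power_mult_distrib power_mult)
      moreover have "x * y / f / (g * h) * (w * (k * l * z)) = w * (x * (k / g * (l / h)) * (y * z / f))"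
        for x y z f g h k l w :: real
        by (simp only: divide_inverse inverse_mult_distrib mult_ac)
      ultimately show "(\<Sum>u\<le>i. (- t) ^ i * (t / 2) ^ j / fact j / (fact u * fact (i - u)) *
          (exp (- t / 2 * weight2 s) * (K (fst s) ^ u * K (snd s) ^ (i - u) * Y s ^ (2 * j))))
        = exp (- t / 2 * weight2 s) * ((- t * X s) ^ i / fact i * ((t / 2 * (Y s)\<^sup>2) ^ j / fact j))"
        by (simp only: sum_distrib_left sum_distrib_right)
    qed
    finally show ?thesis
      unfolding d_def by (simp add: infsumI sum_distrib_left)
  qed
  have mom_odd1: "mom u v l = 0" if "odd u" for u v l
    unfolding mom_def
  proof (rule infsum_odd_eq_0)
    \<comment> \<open>Conjugating one component alone preserves both sizes, hence
      \<open>weight2\<close> and \<open>Y\<close>, and flips a single content.\<close>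
    show "bij_betw (\<lambda>s. (conjugate (fst s), snd s)) S S"
      unfolding S_def
      by (rule bij_betwI[where g = "\<lambda>s. (conjugate (fst s), snd s)"])
        (auto simp: is_partition_conjugate conjugate_conjugate)
  qed (use that in \<open>auto simp: S_def weight2_def Y_def conjugate_weights case_prod_unfold\<close>)
  have mom_odd2: "mom u v l = 0" if "odd v" for u v l
    unfolding mom_def
  proof (rule infsum_odd_eq_0)
    show "bij_betw (\<lambda>s. (fst s, conjugate (snd s))) S S"
      unfolding S_def
      by (rule bij_betwI[where g = "\<lambda>s. (fst s, conjugate (snd s))"])
        (auto simp: is_partition_conjugate conjugate_conjugate)
  qed (use that in \<open>auto simp: S_def weight2_def Y_def conjugate_weights case_prod_unfold\<close>)
  have d_odd: "d i j = 0" if "odd i" for i j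
  proof -
    \<comment> \<open>For odd \<open>i\<close> one of \<open>u\<close> and \<open>i - u\<close> is
      odd, so one of the two conjugations applies.\<close>
    have "mom u (i - u) j = 0" if "u \<le> i" for u
      using \<open>odd i\<close> that by (cases "odd u") (auto intro: mom_odd1 mom_odd2)
    then show ?thesis unfolding d_eq by simp
  qed
  have d_even: "d (2 * i) j = (\<Sum>u\<le>i. t ^ (2 * i + j) * mom (2 * u) (2 * (i - u)) j / (2 ^ j * fact (2 * u) * fact (2 * (i - u)) * fact j))" for i j
  proof -
    have "(\<Sum>u\<le>2 * i. mom u (2 * i - u) j / (fact u * fact (2 * i - u)))
        = (\<Sum>u\<le>i. mom (2 * u) (2 * i - 2 * u) j / (fact (2 * u) * fact (2 * i - 2 * u)))"
      by (rule sum_even_indices) (simp add: mom_odd1)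
    also have "\<dots> = (\<Sum>u\<le>i. mom (2 * u) (2 * (i - u)) j / (fact (2 * u) * fact (2 * (i - u))))"
      by (simp only: diff_mult_distrib2)
    finally have "(\<Sum>u\<le>2 * i. mom u (2 * i - u) j / (fact u * fact (2 * i - u)))
        = (\<Sum>u\<le>i. mom (2 * u) (2 * (i - u)) j / (fact (2 * u) * fact (2 * (i - u))))" .
    then show ?thesis
      unfolding d_eq by (simp add: sum_distrib_left power_add power_divide mult_ac)
  qed
  have coeff: "even_coeff_A k t = (\<Sum>i\<le>k. d (2 * i) (k - i))" for k
  proof -
    define g where "g = (\<lambda>k1 k2 k3. t ^ (2 * k - k3) * mom (2 * k1) (2 * k2) k3 / (2 ^ k3 * fact (2 * k1) * fact (2 * k2) * fact k3))"
    have exps: "measure_pmf.expectation (pair_pmf (q_uniform (q_of t)) (q_uniform (q_of t)))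
        (\<lambda>(\<alpha>, \<beta>). K \<alpha> ^ (2 * k1) * K \<beta> ^ (2 * k2) * (weight \<alpha> - weight \<beta>) ^ (2 * k3))
      = (\<phi> (q_of t))\<^sup>2 * mom (2 * k1) (2 * k2) k3" for k1 k2 k3
      using expectation_q_uniform2[OF t pb, of "2 * k1" "2 * k2" k3]
      by (simp add: mom_def S_def Y_def case_prod_unfold)
    have "even_coeff_A k t = 1 / (\<phi> (q_of t))\<^sup>2 *
        (\<Sum>(k1, k2, k3)\<in>{(k1, k2, k3). k1 + k2 + k3 = k}. (\<phi> (q_of t))\<^sup>2 * g k1 k2 k3)"
      unfolding even_coeff_A_def exps g_def by (simp add: mult_ac)
    also have "\<dots> = (\<Sum>(k1, k2, k3)\<in>{(k1, k2, k3). k1 + k2 + k3 = k}. g k1 k2 k3)"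
      using euler_factors(3)[of "q_of t"] q_of[OF t] by (simp add: sum_distrib_left[symmetric] case_prod_unfold)
    also have "\<dots> = (\<Sum>i\<le>k. \<Sum>j\<le>i. g j (i - j) (k - i))"
      by (rule sum_triples[symmetric])
    also have "\<dots> = (\<Sum>i\<le>k. d (2 * i) (k - i))"
    proof (intro sum.cong refl)
      fix i assume "i \<in> {..k}"
      \<comment> \<open>The power of \<open>t\<close> collects \<open>2 * i\<close> from the
        contents and \<open>k3 = k - i\<close> from the factor \<open>t / 2\<close> of the squared
        difference; the latter also explains \<open>2 ^ k3\<close> in the denominator.\<close>
      then have "2 * k - (k - i) = 2 * i + (k - i)" by simp
      then show "(\<Sum>j\<le>i. g j (i - j) (k - i)) = d (2 * i) (k - i)"
        unfolding d_even g_def by simp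
    qed
    finally show ?thesis .
  qed
  define D where "D = (\<lambda>N. short_partitions ((N + 1) div 2 - 1) \<times> short_partitions (N div 2))"
  have "(\<lambda>N. heat_trace Type_A N t - (\<Sum>(i, j) | i + 2 * j \<le> 2 * p + 1. d i j / real N ^ (i + 2 * j)))
      \<in> O[along Type_A](\<lambda>N. 1 / real N ^ Suc (2 * p + 1))"
    unfolding d_def along_def S_def
  proof (rule two.two_scale_expansion[OF t, where D = D])
    show "two.poly_bounded (\<lambda>s. - t * X s)" "two.poly_bounded (\<lambda>s. t / 2 * (Y s)\<^sup>2)"
      unfolding X_def Y_def by (intro two.poly_bounded_intros poly_bounded_two)+
    show "D N \<subseteq> partitions \<times> partitions" for N by (auto simp: D_def short_partitions_def)
    fix N assume "admissible Type_A N"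
    then have N: "0 < N" by simp
    note lb = length_bounds[OF N]
    show "heat_trace Type_A N t = (\<Sum>\<^sub>\<infinity>s\<in>D N. exp (- t / 2 * weight2 s + - t * X s / real N + t / 2 * (Y s)\<^sup>2 / (real N)\<^sup>2))"
      unfolding heat_trace_A[OF N] D_def by (simp add: weight2_def X_def Y_def case_prod_unfold)
    show "real N \<le> 2 * (1 + weight2 s)" if s_in: "s \<in> partitions \<times> partitions" and s_out: "s \<notin> D N" for s
    proof -
      obtain \<alpha> \<beta> where s: "s = (\<alpha>, \<beta>)" "is_partition \<alpha>" "is_partition \<beta>" using s_in by (cases s) auto
      then have "\<alpha> \<notin> short_partitions ((N + 1) div 2 - 1) \<or> \<beta> \<notin> short_partitions (N div 2)"
        using s_out by (auto simp: D_def)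
      then consider "real N \<le> 2 * weight \<alpha>" | "real N \<le> 2 * weight \<beta>"
        using short_partitions_exhaust[OF s(2) _ lb(3)] short_partitions_exhaust[OF s(3) _ lb(4)] by blast
      then have "real N \<le> 2 * weight \<alpha> + 2 * weight \<beta>" by cases auto
      then show ?thesis
        unfolding s weight2_def prod.case by argo
    qed
    show "- t * X s / real N + t / 2 * (Y s)\<^sup>2 / (real N)\<^sup>2 \<le> t / 4 * weight2 s" if "s \<in> D N" for s
    proof -
      have s: "fst s \<in> short_partitions ((N + 1) div 2 - 1)" "snd s \<in> short_partitions (N div 2)"
        using that by (auto simp: D_def)
      have "0 \<le> (Y s)\<^sup>2 / (real N)\<^sup>2" by simp
      then have "- X s / real N + (Y s)\<^sup>2 / (real N)\<^sup>2 / 2 \<le> weight2 s / 4"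
      proof -
        have "x + y / 2 \<le> z" if "x + y \<le> z" "0 \<le> y" for x y z :: real using that by linarith
        from this[OF pair_exponent_bound[OF s lb(1,2) N]] show ?thesis
          by (simp add: X_def Y_def weight2_def case_prod_unfold)
      qed
      then have "t * (- X s / real N + (Y s)\<^sup>2 / (real N)\<^sup>2 / 2) \<le> t * (weight2 s / 4)"
        using t by (intro mult_left_mono) auto
      then show ?thesis by (simp add: algebra_simps)
    qed
  qed
  moreover have "(\<Sum>(i, j) | i + 2 * j \<le> 2 * p + 1. d i j / real N ^ (i + 2 * j))
      = (\<Sum>k = 0..p. even_coeff_A k t / real N ^ (2 * k))" for N
    using sum_two_scale_even[where c = d and x = "real N" and p = p, OF d_odd] by (simp add: coeff)
  ultimately show ?thesis by simp
qed

theorem theorem1p1: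
  fixes t :: real and p :: nat
  assumes "t > 0" and "p \<ge> 1"
  shows
    "(\<lambda>N. heat_trace Type_A' N t - (\<Sum>k = 0..p. even_coeff_A' k t / real N ^ (2 * k)))
       \<in> O[along Type_A'](\<lambda>N. 1 / real N ^ (2 * p + 2)) \<and>
     (\<lambda>N. heat_trace Type_A N t - (\<Sum>k = 0..p. even_coeff_A k t / real N ^ (2 * k)))
       \<in> O[along Type_A](\<lambda>N. 1 / real N ^ (2 * p + 2)) \<and>
     (\<lambda>N. heat_trace Type_B N t - (\<Sum>k = 0..p. coeff_BD k t / real N ^ k))
       \<in> O[along Type_B](\<lambda>N. 1 / real N ^ (p + 1)) \<and>
     (\<lambda>N. heat_trace Type_C N t - (\<Sum>k = 0..p. coeff_C k t / real N ^ k))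
       \<in> O[along Type_C](\<lambda>N. 1 / real N ^ (p + 1)) \<and>
     (\<lambda>N. heat_trace Type_D N t - (\<Sum>k = 0..p. coeff_BD k t / real N ^ k))
       \<in> O[along Type_D](\<lambda>N. 1 / real N ^ (p + 1))"
  using expansion_A'[OF assms(1)] expansion_A[OF assms(1)] expansion_B[OF assms(1)]
    expansion_C[OF assms(1)] expansion_D[OF assms(1)]
  by blast

end
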